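(* Suppose that $\Gamma$ and $\Gamma'$ are abelian groups. If the odometers $(\mathfrak{X},\Gamma,\Phi)$ and $(\mathfrak{X}',\Gamma',\Phi')$ are return equivalent, then their typesets $\Xi[\mathfrak{X},\Gamma,\Phi]$ and $\Xi[\mathfrak{X}',\Gamma',\Phi']$ are equal.
   Context: Odometers. A Cantor action $(\mathfrak{X},\Gamma,\Phi)$ is an action of a group $\Gamma$ by homeomorphisms on a Cantor space $\mathfrak{X}$; write $g\cdot x=\Phi(g)(x)$. It is minimal if every orbit is dense, and equicontinuous if for a (equivalently any) metric $d_{\mathfrak{X}}$ compatible with the topology, for all $\varepsilon>0$ there is $\delta>0$ such that $d_{\mathfrak{X}}(x,y)<\delta$ implies $d_{\mathfrak{X}}(g\cdot x,g\cdot y)<\varepsilon$ for all $g\in\Gamma$. A ($\Gamma$-)odometer is a minimal equicontinuous Cantor action. Return equivalence. A non-empty clopen set $U\subset\mathfrak{X}$ is adapted if for all $g\in\Gamma$, $g\cdot U\cap U\neq\emptyset$ implies $g\cdot U=U$; then $\Gamma_U=\{g\in\Gamma\mid g\cdot U\cap U\ne\emptyset\}$ is a finite index subgroup which acts on $U$; let $\mathcal{H}_U\subset\mathrm{Homeo}(U)$ be the image of $\Gamma_U$, acting on $U$ by $\Phi_U$. Actions $(\mathfrak{X}_1,\Gamma_1,\Phi_1)$, $(\mathfrak{X}_2,\Gamma_2,\Phi_2)$ are isomorphic if there are a homeomorphism $h\colon\mathfrak{X}_1\to\mathfrak{X}_2$ and a group isomorphism $\Theta\colon\Gamma_1\to\Gamma_2$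 with $\Phi_1(g)=h^{-1}\circ\Phi_2(\Theta(g))\circ h$ for all $g\in\Gamma_1$. Odometers $(\mathfrak{X},\Gamma,\Phi)$ and $(\mathfrak{X}',\Gamma',\Phi')$ are return equivalent if there are adapted sets $U\subset\mathfrak{X}$, $U'\subset\mathfrak{X}'$ such that $(U,\mathcal{H}_U,\Phi_U)$ and $(U',\mathcal{H}'_{U'},\Phi'_{U'})$ are isomorphic. Group chain models. A group chain $\mathcal{G}=\{\Gamma=\Gamma_0\supset\Gamma_1\supset\cdots\}$ is a descending chain of finite index subgroups. Put $X_\ell=\Gamma/\Gamma_\ell$, $X_\infty=\varprojlim\{X_{\ell+1}\to X_\ell\}$, with $\Phi_\infty$ the action of $\Gamma$ on $X_\infty$ induced by left multiplication. $\mathcal{G}$ is a group chain model for $(\mathfrak{X},\Gamma,\Phi)$ if there is a homeomorphism $\mathfrak{X}\to X_\infty$ conjugating $\Phi$ to $\Phi_\infty$ (as $\Gamma$-actions). Every odometer is known to have a group chain model. Types and typesets. A Steinitz number is a formal product $\xi=\prod_{p}p^{\chi_\xi(p)}$ over all primes $p$, with $\chi_\xi(p)\in\{0,1,\ldots,\infty\}$; the least common multiple of a collection of positive integers is a Steinitz number, with exponent at $p$ the supremum of the exponents. $\xi,\xi'$ are asymptotically equivalent if $m\cdot\xi=m'\cdot\xi'$ for some integers $m,m'\ge1$; the equivalence class of $\xi$ is its type $\tau[\xi]$. Given a group chain $\mathcal{G}$, let $C_\ell=\bigcap_{\delta\in\Gamma}\delta\Gamma_\ell\delta^{-1}$ be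 the normal core of $\Gamma_\ell$ in $\Gamma$. For $\gamma\in\Gamma$ let $\xi(\gamma)=\mathrm{lcm}\{\#(\langle\gamma\rangle/(\langle\gamma\rangle\cap C_\ell))\mid\ell>0\}$ and $\tau[\gamma]=\tau[\xi(\gamma)]$. The typeset of $\mathcal{G}$ is $\Xi[\mathcal{G}]=\{\tau[\gamma]\mid\gamma\in\Gamma\}$, and $\Xi[\mathfrak{X},\Gamma,\Phi]=\Xi[\mathcal{G}]$ for a choice of group chain model $\mathcal{G}$ (it does not depend on the choice). *)

theory Defs
  imports "HOL-Analysis.Analysis" "HOL-Algebra.Left_Coset" "HOL-Algebra.Group_Action"
    "HOL-Algebra.Generated_Groups" "HOL-Computational_Algebra.Primes"
begin

section \<open>Odometers\<close>

definition cantor_space :: "'x topology \<Rightarrow> bool" where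
  "cantor_space X \<longleftrightarrow>
     X homeomorphic_space
       product_topology (\<lambda>_::nat. discrete_topology (UNIV :: bool set)) UNIV"

text \<open>The library's \<^locale>\<open>group_action\<close> makes \<open>\<phi>\<close> a homomorphism into the group of all
  bijections of \<open>topspace X\<close>, represented by extensional functions.\<close>

definition cantor_action ::
  "'x topology \<Rightarrow> ('g, 'm) monoid_scheme \<Rightarrow> ('g \<Rightarrow> 'x \<Rightarrow> 'x) \<Rightarrow> bool" where
  "cantor_action X G \<phi> \<longleftrightarrow>
     cantor_space X \<and> group_action G (topspace X) \<phi> \<and>
     (\<forall>g\<in>carrier G. homeomorphic_map X X (\<phi> g))"

definition minimal_action ::
  "'x topology \<Rightarrow> ('g, 'm) monoid_scheme \<Rightarrow> ('g \<Rightarrow> 'x \<Rightarrow> 'x) \<Rightarrow> bool" where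
  "minimal_action X G \<phi> \<longleftrightarrow>
     (\<forall>x\<in>topspace X. X closure_of (orbit G \<phi> x) = topspace X)"

definition equicontinuous_action ::
  "'x topology \<Rightarrow> ('g, 'm) monoid_scheme \<Rightarrow> ('g \<Rightarrow> 'x \<Rightarrow> 'x) \<Rightarrow> bool" where
  "equicontinuous_action X G \<phi> \<longleftrightarrow>
     (\<exists>d. Metric_space (topspace X) d \<and> Metric_space.mtopology (topspace X) d = X \<and>
        (\<forall>\<epsilon>>0. \<exists>\<delta>>0. \<forall>x\<in>topspace X. \<forall>y\<in>topspace X.
           d x y < \<delta> \<longrightarrow> (\<forall>g\<in>carrier G. d (\<phi> g x) (\<phi> g y) < \<epsilon>)))"

definition odometer ::
  "'x topology \<Rightarrow> ('g, 'm) monoid_scheme \<Rightarrow> ('g \<Rightarrow> 'x \<Rightarrow> 'x) \<Rightarrow> bool" where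
  "odometer X G \<phi> \<longleftrightarrow>
     cantor_action X G \<phi> \<and> minimal_action X G \<phi> \<and> equicontinuous_action X G \<phi>"

section \<open>Return equivalence\<close>

definition adapted ::
  "'x topology \<Rightarrow> ('g, 'm) monoid_scheme \<Rightarrow> ('g \<Rightarrow> 'x \<Rightarrow> 'x) \<Rightarrow> 'x set \<Rightarrow> bool" where
  "adapted X G \<phi> U \<longleftrightarrow>
     U \<noteq> {} \<and> openin X U \<and> closedin X U \<and>
     (\<forall>g\<in>carrier G. \<phi> g ` U \<inter> U \<noteq> {} \<longrightarrow> \<phi> g ` U = U)"

definition return_subgroup ::
  "('g, 'm) monoid_scheme \<Rightarrow> ('g \<Rightarrow> 'x \<Rightarrow> 'x) \<Rightarrow> 'x set \<Rightarrow> 'g set" where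
  "return_subgroup G \<phi> U = {g \<in> carrier G. \<phi> g ` U \<inter> U \<noteq> {}}"

text \<open>The image of the return subgroup in \<open>Homeo(U)\<close>, as a group under composition.
  Elements of the image are maps of \<open>U\<close>, so the identity function is its action on \<open>U\<close>.\<close>

definition return_group ::
  "('g, 'm) monoid_scheme \<Rightarrow> ('g \<Rightarrow> 'x \<Rightarrow> 'x) \<Rightarrow> 'x set \<Rightarrow> ('x \<Rightarrow> 'x) monoid" where
  "return_group G \<phi> U =
     (BijGroup U)\<lparr>carrier := (\<lambda>g. restrict (\<phi> g) U) ` return_subgroup G \<phi> U\<rparr>"

definition isomorphic_actions ::
  "'x topology \<Rightarrow> ('g, 'm) monoid_scheme \<Rightarrow> ('g \<Rightarrow> 'x \<Rightarrow> 'x) \<Rightarrow>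
   'y topology \<Rightarrow> ('h, 'n) monoid_scheme \<Rightarrow> ('h \<Rightarrow> 'y \<Rightarrow> 'y) \<Rightarrow> bool" where
  "isomorphic_actions X1 G1 \<phi>1 X2 G2 \<phi>2 \<longleftrightarrow>
     (\<exists>h \<Theta>. homeomorphic_map X1 X2 h \<and> \<Theta> \<in> iso G1 G2 \<and>
        (\<forall>g\<in>carrier G1. \<forall>x\<in>topspace X1.
           \<phi>1 g x = inv_into (topspace X1) h (\<phi>2 (\<Theta> g) (h x))))"

definition return_equivalent ::
  "'x topology \<Rightarrow> ('g, 'm) monoid_scheme \<Rightarrow> ('g \<Rightarrow> 'x \<Rightarrow> 'x) \<Rightarrow>
   'y topology \<Rightarrow> ('h, 'n) monoid_scheme \<Rightarrow> ('h \<Rightarrow> 'y \<Rightarrow> 'y) \<Rightarrow> bool" where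
  "return_equivalent X G \<phi> X' G' \<phi>' \<longleftrightarrow>
     (\<exists>U U'. adapted X G \<phi> U \<and> adapted X' G' \<phi>' U' \<and>
        isomorphic_actions
          (subtopology X U) (return_group G \<phi> U) (\<lambda>f. f)
          (subtopology X' U') (return_group G' \<phi>' U') (\<lambda>f. f))"

section \<open>Group chain models\<close>

text \<open>Inclusions in a chain need not be strict.\<close>

definition group_chain :: "('g, 'm) monoid_scheme \<Rightarrow> (nat \<Rightarrow> 'g set) \<Rightarrow> bool" where
  "group_chain G C \<longleftrightarrow>
     C 0 = carrier G \<and>
     (\<forall>l. subgroup (C l) G \<and> C (Suc l) \<subseteq> C l \<and> finite (lcosets\<^bsub>G\<^esub> (C l)))"

text \<open>The bonding map \<open>g C(l+1) \<mapsto> g C(l)\<close> is \<open>A \<mapsto> A C(l)\<close> (product of subsets).\<close>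

definition chain_limit ::
  "('g, 'm) monoid_scheme \<Rightarrow> (nat \<Rightarrow> 'g set) \<Rightarrow> (nat \<Rightarrow> 'g set) topology" where
  "chain_limit G C =
     subtopology (product_topology (\<lambda>l. discrete_topology (lcosets\<^bsub>G\<^esub> (C l))) UNIV)
       {A. \<forall>l. A (Suc l) <#>\<^bsub>G\<^esub> C l = A l}"

definition chain_action ::
  "('g, 'm) monoid_scheme \<Rightarrow> 'g \<Rightarrow> (nat \<Rightarrow> 'g set) \<Rightarrow> (nat \<Rightarrow> 'g set)" where
  "chain_action G g A = (\<lambda>l. g <#\<^bsub>G\<^esub> A l)"

definition group_chain_model ::
  "'x topology \<Rightarrow> ('g, 'm) monoid_scheme \<Rightarrow> ('g \<Rightarrow> 'x \<Rightarrow> 'x) \<Rightarrow> (nat \<Rightarrow> 'g set) \<Rightarrow> bool" where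
  "group_chain_model X G \<phi> C \<longleftrightarrow>
     group_chain G C \<and>
     (\<exists>h. homeomorphic_map X (chain_limit G C) h \<and>
        (\<forall>g\<in>carrier G. \<forall>x\<in>topspace X. h (\<phi> g x) = chain_action G g (h x)))"

section \<open>Types\<close>

text \<open>A Steinitz number is represented by its exponent function; the values at
  non-primes carry no information and are fixed to be \<open>0\<close>.\<close>

definition steinitz_numbers :: "(nat \<Rightarrow> enat) set" where
  "steinitz_numbers = {\<xi>. \<forall>p. \<not> prime p \<longrightarrow> \<xi> p = 0}"

definition steinitz_of_nat :: "nat \<Rightarrow> nat \<Rightarrow> enat" where
  "steinitz_of_nat m = (\<lambda>p. if prime p then enat (multiplicity p m) else 0)"

definition steinitz_mult :: "(nat \<Rightarrow> enat) \<Rightarrow> (nat \<Rightarrow> enat) \<Rightarrow> nat \<Rightarrow> enat" where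
  "steinitz_mult \<xi> \<xi>' = (\<lambda>p. \<xi> p + \<xi>' p)"

definition steinitz_lcm :: "nat set \<Rightarrow> nat \<Rightarrow> enat" where
  "steinitz_lcm M = (\<lambda>p. SUP m\<in>M. steinitz_of_nat m p)"

definition asymptotic_rel :: "((nat \<Rightarrow> enat) \<times> (nat \<Rightarrow> enat)) set" where
  "asymptotic_rel =
     {(\<xi>, \<xi>'). \<xi> \<in> steinitz_numbers \<and> \<xi>' \<in> steinitz_numbers \<and>
        (\<exists>m m'. m \<ge> 1 \<and> m' \<ge> 1 \<and>
           steinitz_mult (steinitz_of_nat m) \<xi> = steinitz_mult (steinitz_of_nat m') \<xi>')}"

definition steinitz_type :: "(nat \<Rightarrow> enat) \<Rightarrow> (nat \<Rightarrow> enat) set" where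
  "steinitz_type \<xi> = asymptotic_rel `` {\<xi>}"

section \<open>Typesets\<close>

definition normal_core :: "('g, 'm) monoid_scheme \<Rightarrow> 'g set \<Rightarrow> 'g set" where
  "normal_core G H = (\<Inter>\<delta>\<in>carrier G. (\<delta> <#\<^bsub>G\<^esub> H) #>\<^bsub>G\<^esub> (inv\<^bsub>G\<^esub> \<delta>))"

definition cyclic_index :: "('g, 'm) monoid_scheme \<Rightarrow> 'g \<Rightarrow> 'g set \<Rightarrow> nat" where
  "cyclic_index G \<gamma> N =
     order (subgroup_generated G {\<gamma>} Mod (carrier (subgroup_generated G {\<gamma>}) \<inter> N))"

definition steinitz_order :: "('g, 'm) monoid_scheme \<Rightarrow> (nat \<Rightarrow> 'g set) \<Rightarrow> 'g \<Rightarrow> nat \<Rightarrow> enat" where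
  "steinitz_order G C \<gamma> = steinitz_lcm {cyclic_index G \<gamma> (normal_core G (C l)) | l. l > 0}"

definition chain_typeset ::
  "('g, 'm) monoid_scheme \<Rightarrow> (nat \<Rightarrow> 'g set) \<Rightarrow> (nat \<Rightarrow> enat) set set" where
  "chain_typeset G C = {steinitz_type (steinitz_order G C \<gamma>) | \<gamma>. \<gamma> \<in> carrier G}"

definition typeset ::
  "'x topology \<Rightarrow> ('g, 'm) monoid_scheme \<Rightarrow> ('g \<Rightarrow> 'x \<Rightarrow> 'x) \<Rightarrow> (nat \<Rightarrow> enat) set set" where
  "typeset X G \<phi> = chain_typeset G (SOME C. group_chain_model X G \<phi> C)"

end

theory Submission
  imports Defs "HOL-Algebra.Elementary_Groups"
begin

text \<open>
  The Steinitz order of \<open>\<gamma>\<close> does not depend on the chain: it is the least common multiple of the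
  periods under \<open>\<gamma>\<close> of all adapted sets, because for an abelian group the cylinder sets at level \<open>l\<close>
  of a chain model are adapted with return subgroup \<open>C l\<close>, and every adapted set contains one of them.
  Deep cylinders around a point of an adapted set \<open>U\<close> lie in \<open>U\<close>, so only the adapted subsets of \<open>U\<close>
  matter. If \<open>m\<close> is the period of \<open>U\<close>, then \<open>m\<close> divides the periods of these subsets under \<open>\<gamma>\<close>, so that
  \<open>\<xi>(\<gamma>) = m \<cdot> \<xi>(\<gamma>\<^sup>m)\<close>, where the second order is computed in the return action on \<open>U\<close>. Hence the typeset
  is determined by the return action, up to isomorphism.
\<close>

section \<open>Steinitz numbers\<close>

text \<open>In the nontrivial direction a finite bound \<open>s\<close> on all values
  \<open>c + f a\<close> gives the bound \<open>s - c\<close> on all \<open>f a\<close>. A member of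
  \<open>A\<close> is needed to get \<open>c \<le> s\<close>: over the empty set the left side is 0
  and the right side is \<open>c\<close>.\<close>

lemma enat_SUP_add_left:
  fixes f :: "'a \<Rightarrow> enat"
  assumes "A \<noteq> {}"
  shows "(SUP a\<in>A. enat c + f a) = enat c + (SUP a\<in>A. f a)"
proof (rule antisym)
  show "(SUP a\<in>A. enat c + f a) \<le> enat c + (SUP a\<in>A. f a)"
    by (intro SUP_least add_left_mono SUP_upper)
  obtain b where b: "b \<in> A" using assms by blast
  let ?S = "SUP a\<in>A. enat c + f a"
  have le: "enat c + f a \<le> ?S" if "a \<in> A" for a
    using that by (rule SUP_upper)
  show "enat c + (SUP a\<in>A. f a) \<le> ?S"
  proof (cases ?S)
    case (enat s)
    have "f a \<le> enat (s - c)" if "a \<in> A" for a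
      using le[OF that] unfolding enat by (cases "f a") auto
    then have "(SUP a\<in>A. f a) \<le> enat (s - c)"
      by (intro SUP_least)
    moreover have "c \<le> s"
      using le[OF b] unfolding enat by (cases "f b") auto
    ultimately show ?thesis
      unfolding enat by (cases "SUP a\<in>A. f a") auto
  qed simp
qed

lemma steinitz_of_nat_mult:
  assumes "0 < a" "0 < b"
  shows "steinitz_of_nat (a * b) = steinitz_mult (steinitz_of_nat a) (steinitz_of_nat b)"
  using assms
  by (auto simp: steinitz_of_nat_def steinitz_mult_def prime_elem_multiplicity_mult_distrib)

text \<open>The case \<open>b = 0\<close> is excluded because every number divides 0, while all
  multiplicities in 0 are 0 by convention.\<close>

lemma steinitz_of_nat_dvd_mono:
  assumes "a dvd b" "0 < b"
  shows "steinitz_of_nat a p \<le> steinitz_of_nat b p"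
  using assms by (simp add: steinitz_of_nat_def dvd_imp_multiplicity_le)

lemma steinitz_lcm_in_steinitz_numbers: "steinitz_lcm M \<in> steinitz_numbers"
  by (auto simp: steinitz_numbers_def steinitz_lcm_def steinitz_of_nat_def
      simp flip: bot_enat_def)

text \<open>Exponents of products of positive numbers add up, and the exponent of \<open>m\<close>
  is finite at every prime, so adding it commutes with the supremum.\<close>

lemma steinitz_lcm_mult:
  assumes "M \<noteq> {}" "0 < m" "\<And>a. a \<in> M \<Longrightarrow> 0 < a"
  shows "steinitz_lcm ((*) m ` M) = steinitz_mult (steinitz_of_nat m) (steinitz_lcm M)"
proof
  fix p
  have "steinitz_lcm ((*) m ` M) p = (SUP a\<in>M. steinitz_of_nat m p + steinitz_of_nat a p)"
    using assms
    by (auto simp: steinitz_lcm_def image_image steinitz_of_nat_mult steinitz_mult_def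
        intro!: SUP_cong)
  also have "\<dots> = steinitz_of_nat m p + steinitz_lcm M p"
    unfolding steinitz_lcm_def using enat_SUP_add_left[OF assms(1)]
    by (cases "steinitz_of_nat m p") (auto simp: steinitz_of_nat_def split: if_splits)
  finally show "steinitz_lcm ((*) m ` M) p = steinitz_mult (steinitz_of_nat m) (steinitz_lcm M) p"
    by (simp add: steinitz_mult_def)
qed

lemma steinitz_lcm_dvd_mono:
  assumes "\<And>a. a \<in> A \<Longrightarrow> \<exists>b\<in>B. a dvd b \<and> 0 < b"
  shows "steinitz_lcm A \<le> steinitz_lcm B"
proof (rule le_funI)
  fix p
  show "steinitz_lcm A p \<le> steinitz_lcm B p"
    unfolding steinitz_lcm_def
  proof (rule SUP_mono)
    fix a assume "a \<in> A"
    then obtain b where "b \<in> B" "a dvd b" "0 < b" using assms by blast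
    then show "\<exists>b\<in>B. steinitz_of_nat a p \<le> steinitz_of_nat b p"
      using steinitz_of_nat_dvd_mono by blast
  qed
qed

text \<open>This is used to replace the periods of all adapted sets by those of a family that is
  cofinal for divisibility: the cylinders, or the adapted subsets of a fixed adapted set.\<close>

lemma steinitz_lcm_cofinal:
  assumes "B \<subseteq> A" "\<And>a. a \<in> A \<Longrightarrow> \<exists>b\<in>B. a dvd b" "\<And>b. b \<in> B \<Longrightarrow> 0 < b"
  shows "steinitz_lcm A = steinitz_lcm B"
proof (rule antisym)
  show "steinitz_lcm A \<le> steinitz_lcm B"
    using assms by (intro steinitz_lcm_dvd_mono) blast
  show "steinitz_lcm B \<le> steinitz_lcm A"
    using assms by (intro steinitz_lcm_dvd_mono) blast
qed

text \<open>A pair of factors \<open>(m, m')\<close> relating \<open>k \<xi>\<close> to \<eta>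
  becomes \<open>(m * k, m')\<close> for \<xi>, and a pair \<open>(m, m')\<close> relating \<xi> to
  \<eta> becomes \<open>(m, k * m')\<close> for \<open>k \<xi>\<close>.\<close>

lemma steinitz_type_mult:
  assumes "0 < k" "\<xi> \<in> steinitz_numbers"
  shows "steinitz_type (steinitz_mult (steinitz_of_nat k) \<xi>) = steinitz_type \<xi>"
proof -
  have assoc: "steinitz_mult (steinitz_of_nat m) (steinitz_mult (steinitz_of_nat k) \<eta>)
      = steinitz_mult (steinitz_of_nat (m * k)) \<eta>" if "m \<ge> 1" for m \<eta>
    using assms that by (auto simp: steinitz_of_nat_mult steinitz_mult_def add.assoc)
  have num: "steinitz_mult (steinitz_of_nat k) \<xi> \<in> steinitz_numbers"
    using assms(2) by (auto simp: steinitz_numbers_def steinitz_mult_def steinitz_of_nat_def)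
  have "(steinitz_mult (steinitz_of_nat k) \<xi>, \<eta>) \<in> asymptotic_rel \<longleftrightarrow> (\<xi>, \<eta>) \<in> asymptotic_rel"
    for \<eta>
  proof
    assume "(steinitz_mult (steinitz_of_nat k) \<xi>, \<eta>) \<in> asymptotic_rel"
    then obtain m m' where "m \<ge> 1" "m' \<ge> 1" "\<eta> \<in> steinitz_numbers"
      "steinitz_mult (steinitz_of_nat (m * k)) \<xi> = steinitz_mult (steinitz_of_nat m') \<eta>"
      unfolding asymptotic_rel_def using assoc by auto
    moreover from this have "m * k \<ge> 1" using assms(1) by simp
    ultimately show "(\<xi>, \<eta>) \<in> asymptotic_rel"
      unfolding asymptotic_rel_def using assms(2) by blast
  next
    assume "(\<xi>, \<eta>) \<in> asymptotic_rel"
    then obtain m m' where m: "m \<ge> 1" "m' \<ge> 1" "\<eta> \<in> steinitz_numbers"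
      "steinitz_mult (steinitz_of_nat m) \<xi> = steinitz_mult (steinitz_of_nat m') \<eta>"
      unfolding asymptotic_rel_def by auto
    have "steinitz_mult (steinitz_of_nat m) (steinitz_mult (steinitz_of_nat k) \<xi>)
        = steinitz_mult (steinitz_of_nat k) (steinitz_mult (steinitz_of_nat m) \<xi>)"
      by (simp add: steinitz_mult_def add.left_commute)
    also have "\<dots> = steinitz_mult (steinitz_of_nat (k * m')) \<eta>"
      using assms(1) m by (auto simp: steinitz_of_nat_mult steinitz_mult_def add.assoc)
    finally have eq: "steinitz_mult (steinitz_of_nat m) (steinitz_mult (steinitz_of_nat k) \<xi>)
        = steinitz_mult (steinitz_of_nat (k * m')) \<eta>" .
    have "k * m' \<ge> 1" using assms(1) m by simp
    with eq m num show "(steinitz_mult (steinitz_of_nat k) \<xi>, \<eta>) \<in> asymptotic_rel"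
      unfolding asymptotic_rel_def by blast
  qed
  then show ?thesis by (auto simp: steinitz_type_def)
qed

section \<open>Least periods\<close>

text \<open>Applied below to the image map on sets, so that the points are adapted sets. Without a
  positive return time the value of \<open>LEAST\<close> is unspecified, which is why later lemmas
  assume \<open>periodic\<close>.\<close>

definition least_period :: "('a \<Rightarrow> 'a) \<Rightarrow> 'a \<Rightarrow> nat" where
  "least_period f x = (LEAST n. 0 < n \<and> (f ^^ n) x = x)"

definition periodic :: "('a \<Rightarrow> 'a) \<Rightarrow> 'a \<Rightarrow> bool" where
  "periodic f x \<longleftrightarrow> (\<exists>n>0. (f ^^ n) x = x)"

lemma least_period_props:
  assumes "periodic f x"
  shows "0 < least_period f x" "(f ^^ least_period f x) x = x"
  using LeastI_ex[of "\<lambda>n. 0 < n \<and> (f ^^ n) x = x"] assms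
  unfolding least_period_def periodic_def by auto

lemma funpow_eq_iff_least_period_dvd:
  assumes "periodic f x"
  shows "(f ^^ k) x = x \<longleftrightarrow> least_period f x dvd k"
proof
  let ?n = "least_period f x"
  note n = least_period_props[OF assms]
  assume "(f ^^ k) x = x"
  then have "(f ^^ (k mod ?n)) x = x"
    using funpow_mod_eq[OF n(2)] by simp
  moreover have "k mod ?n < ?n" using n(1) by simp
  ultimately have "k mod ?n = 0"
    using not_less_Least[of "k mod ?n" "\<lambda>n. 0 < n \<and> (f ^^ n) x = x"]
    unfolding least_period_def by auto
  then show "?n dvd k" by auto
next
  assume "least_period f x dvd k"
  then have "k mod least_period f x = 0" by auto
  then show "(f ^^ k) x = x"
    using funpow_mod_eq[OF least_period_props(2)[OF assms], of k] by simp
qed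

text \<open>The period depends only on the set of return times. This allows comparing periods in
  different actions and at different points.\<close>

lemma least_period_cong:
  assumes "\<And>n. (f ^^ n) x = x \<longleftrightarrow> (g ^^ n) y = y"
  shows "least_period f x = least_period g y"
  using assms by (simp add: least_period_def)

text \<open>If \<open>f\<close> has period \<open>m * k\<close> at \<open>x\<close>, then the
  \<open>n\<close>-th iterate of \<open>f ^^ m\<close> fixes \<open>x\<close> exactly if
  \<open>m * k\<close> divides \<open>m * n\<close>, that is, if \<open>k\<close> divides
  \<open>n\<close>.\<close>

lemma least_period_funpow:
  assumes "periodic f x" "m dvd least_period f x"
  shows "periodic (f ^^ m) x" "least_period f x = m * least_period (f ^^ m) x"
proof -
  obtain k where k: "least_period f x = m * k" using assms(2) by blast
  have pos: "0 < m" "0 < k"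
    using least_period_props(1)[OF assms(1)] k by auto
  have pow: "((f ^^ m) ^^ n) x = x \<longleftrightarrow> k dvd n" for n
    using funpow_eq_iff_least_period_dvd[OF assms(1), of "m * n"] pos
    unfolding k by (simp add: funpow_mult)
  show per: "periodic (f ^^ m) x"
    unfolding periodic_def using pow[of k] pos by (intro exI[of _ k]) simp
  have "least_period (f ^^ m) x dvd n \<longleftrightarrow> k dvd n" for n
    using funpow_eq_iff_least_period_dvd[OF per] pow by simp
  \<comment> \<open>Two numbers with the same multiples are equal; each instance gives one of the
    two divisibilities.\<close>
  from this[of k] this[of "least_period (f ^^ m) x"]
  have "least_period (f ^^ m) x = k"
    by (intro dvd_antisym) simp_all
  then show "least_period f x = m * least_period (f ^^ m) x"
    using k by simp
qed

lemma image_funpow: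
  fixes f :: "'a \<Rightarrow> 'a"
  shows "((`) f ^^ n) A = (f ^^ n) ` A"
  by (induction n) (simp_all add: image_image)

section \<open>The index of a cyclic subgroup\<close>

lemma (in group) subgroup_mult_mem_iff:
  assumes H: "subgroup H G" and h: "h \<in> H" and x: "x \<in> carrier G"
  shows "h \<otimes> x \<in> H \<longleftrightarrow> x \<in> H"
proof
  interpret H: subgroup H G by fact
  assume "h \<otimes> x \<in> H"
  then have "inv h \<otimes> (h \<otimes> x) \<in> H" using h by blast
  then show "x \<in> H" using h x by (simp add: m_assoc[symmetric])
qed (use H h in \<open>simp add: subgroup.m_closed\<close>)

text \<open>Division with remainder: the remainder of \<open>i\<close> modulo \<open>n\<close> is a
  natural exponent below \<open>n\<close>, which \<open>least\<close> rules out unless it is 0.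
  Integer exponents are treated because a cyclic subgroup consists of integer powers.\<close>

lemma (in group) int_pow_in_subgroup_iff:
  assumes H: "subgroup H G" and g: "g \<in> carrier G" and n: "0 < n" "g [^] n \<in> H"
    and least: "\<And>k::nat. 0 < k \<Longrightarrow> k < n \<Longrightarrow> g [^] k \<notin> H"
  shows "g [^] (i::int) \<in> H \<longleftrightarrow> int n dvd i"
proof -
  interpret H: subgroup H G by fact
  have mult: "g [^] (int n * j) \<in> H" for j
  proof -
    have "g [^] (int n * j) = (g [^] n) [^] j"
      using int_pow_pow[OF g, of "int n" j] int_pow_int[of G g n] by simp
    then show ?thesis
      using subgroup_int_pow_closed[OF H n(2)] by simp
  qed
  let ?r = "i mod int n"
  have "g [^] i = g [^] (int n * (i div int n)) \<otimes> g [^] ?r"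
    using int_pow_mult[OF g, of "int n * (i div int n)" ?r] by simp
  then have r: "g [^] i \<in> H \<longleftrightarrow> g [^] ?r \<in> H"
    using subgroup_mult_mem_iff[OF H mult[of "i div int n"]] g by simp
  show ?thesis
  proof
    assume "g [^] i \<in> H"
    then have "g [^] nat ?r \<in> H"
      using r n(1) int_pow_int[of G g "nat ?r"] by simp
    moreover have "nat ?r < n"
      using n(1) by (simp add: nat_less_iff)
    ultimately have "nat ?r = 0" using least by blast
    moreover have "0 \<le> ?r" using n(1) by simp
    ultimately have "?r = 0" by linarith
    then show "int n dvd i" by auto
  next
    assume "int n dvd i"
    then obtain j where "i = int n * j" by (rule dvdE)
    then show "g [^] i \<in> H" using mult by simp
  qed
qed

text \<open>The cosets of the intersection of \<open>H\<close> with the cyclic group of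
  \<open>g\<close> correspond to the residue classes of exponents modulo the least positive
  \<open>n\<close> with \<open>g [^] n\<close> in \<open>H\<close>.\<close>

lemma (in group) cyclic_index_eq:
  assumes H: "subgroup H G" and g: "g \<in> carrier G" and ex: "\<exists>n::nat>0. g [^] n \<in> H"
  shows "cyclic_index G g H = (LEAST n::nat. 0 < n \<and> g [^] n \<in> H)"
proof -
  define n where "n = (LEAST n::nat. 0 < n \<and> g [^] n \<in> H)"
  have n: "0 < n" "g [^] n \<in> H"
    using LeastI_ex[of "\<lambda>n::nat. 0 < n \<and> g [^] n \<in> H"] ex unfolding n_def by auto
  have iff: "g [^] (i::int) \<in> H \<longleftrightarrow> int n dvd i" for i
    using int_pow_in_subgroup_iff[OF H g n] not_less_Least[of _ "\<lambda>n::nat. 0 < n \<and> g [^] n \<in> H"]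
    unfolding n_def by blast
  define K where "K = subgroup_generated G {g}"
  define N where "N = carrier K \<inter> H"
  have carK: "carrier K = range (\<lambda>i::int. g [^] i)"
    unfolding K_def by (rule carrier_subgroup_generated_by_singleton[OF g])
  have multK: "x \<otimes>\<^bsub>K\<^esub> y = x \<otimes> y" for x y unfolding K_def by simp
  have coset: "N #>\<^bsub>K\<^esub> (g [^] i) = {g [^] (j::int) |j. int n dvd j - i}" for i :: int
  proof -
    have "N = {g [^] (k::int) |k. int n dvd k}"
      unfolding N_def carK using iff by blast
    then have "N #>\<^bsub>K\<^esub> (g [^] i) = (\<lambda>k. g [^] k \<otimes> g [^] i) ` {k::int. int n dvd k}"
      unfolding r_coset_def multK by blast
    also have "\<dots> = (\<lambda>k. g [^] (k + i)) ` {k. int n dvd k}"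
      using g by (simp add: int_pow_mult)
    also have "\<dots> = {g [^] (j::int) |j. int n dvd j - i}"
      by (auto intro!: image_eqI[of _ _ "_ - i"])
    finally show ?thesis .
  qed
  have coset_eq: "N #>\<^bsub>K\<^esub> (g [^] i) = N #>\<^bsub>K\<^esub> (g [^] j) \<longleftrightarrow> int n dvd i - j" for i j :: int
  proof
    assume "N #>\<^bsub>K\<^esub> (g [^] i) = N #>\<^bsub>K\<^esub> (g [^] j)"
    moreover have "g [^] i \<in> {g [^] (k::int) |k. int n dvd k - i}" by force
    ultimately have "g [^] i \<in> {g [^] (k::int) |k. int n dvd k - j}"
      unfolding coset by (simp only:)
    then obtain k where k: "g [^] i = g [^] (k::int)" "int n dvd k - j"
      by blast
    \<comment> \<open>Equal powers of \<open>g\<close> need not have equal exponents, since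
      \<open>g\<close> may have finite order. The difference of the exponents is still a multiple of
      \<open>n\<close>, because \<open>\<one>\<close> lies in \<open>H\<close>.\<close>
    from k(1) have "g [^] (i - k) = \<one>"
      using g by (simp add: int_pow_diff)
    then have "int n dvd i - k"
      using iff[of "i - k"] subgroup.one_closed[OF H] by simp
    then have "int n dvd (i - k) + (k - j)" using k(2) by (rule dvd_add)
    then show "int n dvd i - j" by simp
  next
    assume d: "int n dvd i - j"
    have "int n dvd k - i \<longleftrightarrow> int n dvd k - j" for k
    proof -
      have "k - j = (k - i) + (i - j)" by simp
      then show ?thesis using dvd_add_left_iff[OF d, of "k - i"] by (simp only:)
    qed
    then show "N #>\<^bsub>K\<^esub> (g [^] i) = N #>\<^bsub>K\<^esub> (g [^] j)" unfolding coset by simp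
  qed
  have "rcosets\<^bsub>K\<^esub> N = (\<lambda>i::int. N #>\<^bsub>K\<^esub> (g [^] i)) ` {0..<int n}"
  proof -
    have "N #>\<^bsub>K\<^esub> (g [^] i) = N #>\<^bsub>K\<^esub> (g [^] (i mod int n))" for i :: int
      unfolding coset_eq by simp
    moreover have "i mod int n \<in> {0..<int n}" for i using n(1) by simp
    ultimately show ?thesis unfolding RCOSETS_def carK by blast
  qed
  moreover have "inj_on (\<lambda>i::int. N #>\<^bsub>K\<^esub> (g [^] i)) {0..<int n}"
  proof (rule inj_onI)
    fix i j assume ij: "i \<in> {0..<int n}" "j \<in> {0..<int n}"
      "N #>\<^bsub>K\<^esub> (g [^] i) = N #>\<^bsub>K\<^esub> (g [^] j)"
    then have "i mod int n = j mod int n" unfolding coset_eq by (simp only: mod_eq_dvd_iff)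
    with ij(1,2) show "i = j" by simp
  qed
  ultimately have "card (rcosets\<^bsub>K\<^esub> N) = n"
    by (simp add: card_image)
  then show ?thesis
    unfolding cyclic_index_def K_def[symmetric] N_def[symmetric] n_def[symmetric]
    by (simp add: order_def FactGroup_def)
qed

text \<open>By the pigeonhole principle two of the cosets \<open>g [^] i <# H\<close> coincide, and
  the difference of the two exponents serves as \<open>n\<close>.\<close>

lemma (in group) power_in_finite_index_subgroup:
  assumes H: "subgroup H G" and fin: "finite (lcosets H)" and g: "g \<in> carrier G"
  shows "\<exists>n::nat>0. g [^] n \<in> H"
proof -
  have "(\<lambda>i::nat. (g [^] i) <#\<^bsub>G\<^esub> H) ` UNIV \<subseteq> lcosets H"
    unfolding LCOSETS_def using g by auto
  then have "\<not> inj (\<lambda>i::nat. (g [^] i) <#\<^bsub>G\<^esub> H)"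
    using fin finite_subset range_inj_infinite by blast
  then obtain i j where ij: "i < j" "(g [^] i) <#\<^bsub>G\<^esub> H = (g [^] (j::nat)) <#\<^bsub>G\<^esub> H"
    using linorder_injI[of "\<lambda>i::nat. (g [^] i) <#\<^bsub>G\<^esub> H"] by blast
  then have "g [^] j \<in> (g [^] i) <#\<^bsub>G\<^esub> H"
    using lcos_self[OF _ H, of "g [^] j"] g by simp
  then have "inv (g [^] i) \<otimes> g [^] j \<in> H"
    using subgroup.lcos_module_imp[OF H is_group] g by simp
  moreover have "g [^] j = g [^] i \<otimes> g [^] (j - i)"
    using ij(1) g by (simp add: nat_pow_mult)
  ultimately have "g [^] (j - i) \<in> H"
    using g by (simp add: m_assoc[symmetric])
  then show ?thesis using ij(1) by (intro exI[of _ "j - i"]) simp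
qed

text \<open>Conjugation is trivial in an abelian group.\<close>

lemma (in comm_group) normal_core_eq:
  assumes "subgroup H G"
  shows "normal_core G H = H"
proof -
  interpret subgroup H G by fact
  have "(d <#\<^bsub>G\<^esub> H) #> inv d = H" if d: "d \<in> carrier G" for d
  proof -
    have "d \<otimes> h \<otimes> inv d = h" if "h \<in> H" for h
      using that d by (simp add: m_comm[of d] m_assoc)
    then show ?thesis by (auto simp: l_coset_def r_coset_def)
  qed
  then show ?thesis unfolding normal_core_def by auto
qed

section \<open>The typeset of an action\<close>

text \<open>A form of the Steinitz order that mentions no chain. It makes sense for the return
  action too, whose group consists of maps of the adapted set.\<close>

definition action_order ::
  "'x topology \<Rightarrow> ('g, 'm) monoid_scheme \<Rightarrow> ('g \<Rightarrow> 'x \<Rightarrow> 'x) \<Rightarrow> 'g \<Rightarrow> nat \<Rightarrow> enat" where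
  "action_order X G \<phi> g = steinitz_lcm {least_period ((`) (\<phi> g)) V | V. adapted X G \<phi> V}"

definition action_typeset ::
  "'x topology \<Rightarrow> ('g, 'm) monoid_scheme \<Rightarrow> ('g \<Rightarrow> 'x \<Rightarrow> 'x) \<Rightarrow> (nat \<Rightarrow> enat) set set" where
  "action_typeset X G \<phi> = {steinitz_type (action_order X G \<phi> g) | g. g \<in> carrier G}"

text \<open>The bijection \<open>h\<close> carries adapted sets to adapted sets and preserves their
  periods when \<open>g\<close> is replaced by \<open>\<Theta> g\<close>. As \<Theta> is onto, all
  elements of \<open>G2\<close> are reached.\<close>

lemma isomorphic_actions_imp_action_typeset_eq:
  assumes iso: "isomorphic_actions X1 G1 \<phi>1 X2 G2 \<phi>2"
    and maps: "\<And>g. g \<in> carrier G2 \<Longrightarrow> \<phi>2 g ` topspace X2 \<subseteq> topspace X2"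
  shows "action_typeset X1 G1 \<phi>1 = action_typeset X2 G2 \<phi>2"
proof -
  let ?S = "topspace X1" and ?T = "topspace X2"
  obtain h \<Theta> where h: "homeomorphic_map X1 X2 h" and \<Theta>: "\<Theta> \<in> iso G1 G2"
    and eq: "\<And>g x. g \<in> carrier G1 \<Longrightarrow> x \<in> ?S \<Longrightarrow> \<phi>1 g x = inv_into ?S h (\<phi>2 (\<Theta> g) (h x))"
    using iso unfolding isomorphic_actions_def by blast
  have img: "h ` ?S = ?T" and inj: "inj_on h ?S"
    using homeomorphic_imp_surjective_map[OF h] homeomorphic_imp_injective_map[OF h] by auto
  have bij: "\<Theta> ` carrier G1 = carrier G2"
    using \<Theta> by (simp add: iso_def bij_betw_def)
  \<comment> \<open>The equation for \<open>\<phi>1\<close> uses \<open>inv_into\<close>, which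
    cancels \<open>h\<close> only on the image of \<open>h\<close>; the hypothesis
    \<open>maps\<close> places the value of \<open>\<phi>2\<close> there.\<close>
  have step: "\<phi>1 g x \<in> ?S \<and> h (\<phi>1 g x) = \<phi>2 (\<Theta> g) (h x)"
    if g: "g \<in> carrier G1" and x: "x \<in> ?S" for g x
  proof -
    have "\<phi>2 (\<Theta> g) (h x) \<in> h ` ?S"
      using maps[of "\<Theta> g"] bij img g x by blast
    then show ?thesis
      unfolding eq[OF g x] by (simp add: inv_into_into f_inv_into_f)
  qed
  have conj: "\<phi>1 g ` V \<subseteq> ?S \<and> h ` \<phi>1 g ` V = \<phi>2 (\<Theta> g) ` h ` V"
    if g: "g \<in> carrier G1" and V: "V \<subseteq> ?S" for g V
  proof
    show "\<phi>1 g ` V \<subseteq> ?S" using step[OF g] V by blast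
    show "h ` \<phi>1 g ` V = \<phi>2 (\<Theta> g) ` h ` V"
      unfolding image_image using step[OF g] V by (intro image_cong) auto
  qed
  have himg: "h ` A = h ` B \<longleftrightarrow> A = B" if "A \<subseteq> ?S" "B \<subseteq> ?S" for A B
    using inj_on_image_eq_iff[OF inj that] .
  have hint: "h ` A \<inter> h ` B = {} \<longleftrightarrow> A \<inter> B = {}" if "A \<subseteq> ?S" "B \<subseteq> ?S" for A B
    using inj_on_image_Int[OF inj that] by auto
  have adapted: "adapted X1 G1 \<phi>1 V \<longleftrightarrow> adapted X2 G2 \<phi>2 (h ` V)" if V: "V \<subseteq> ?S" for V
  proof -
    have "(\<phi>1 g ` V \<inter> V \<noteq> {} \<longrightarrow> \<phi>1 g ` V = V) \<longleftrightarrow>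
        (\<phi>2 (\<Theta> g) ` h ` V \<inter> h ` V \<noteq> {} \<longrightarrow> \<phi>2 (\<Theta> g) ` h ` V = h ` V)"
      if g: "g \<in> carrier G1" for g
      using conj[OF g V] himg[of "\<phi>1 g ` V" V] hint[of "\<phi>1 g ` V" V] V by simp
    then have "(\<forall>g\<in>carrier G1. \<phi>1 g ` V \<inter> V \<noteq> {} \<longrightarrow> \<phi>1 g ` V = V) \<longleftrightarrow>
        (\<forall>g\<in>carrier G2. \<phi>2 g ` h ` V \<inter> h ` V \<noteq> {} \<longrightarrow> \<phi>2 g ` h ` V = h ` V)"
      unfolding bij[symmetric] by simp
    moreover have "openin X2 (h ` V) \<longleftrightarrow> openin X1 V" "closedin X2 (h ` V) \<longleftrightarrow> closedin X1 V"
      using homeomorphic_map_openness[OF h V] homeomorphic_map_closedness[OF h V] by auto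
    ultimately show ?thesis unfolding adapted_def by simp
  qed
  have funpow: "((`) (\<phi>1 g) ^^ n) V \<subseteq> ?S \<and> h ` ((`) (\<phi>1 g) ^^ n) V = ((`) (\<phi>2 (\<Theta> g)) ^^ n) (h ` V)"
    if g: "g \<in> carrier G1" and V: "V \<subseteq> ?S" for g V n
    by (induction n) (use conj[OF g] V in simp_all)
  have period: "least_period ((`) (\<phi>1 g)) V = least_period ((`) (\<phi>2 (\<Theta> g))) (h ` V)"
    if g: "g \<in> carrier G1" and V: "V \<subseteq> ?S" for g V
  proof (rule least_period_cong)
    fix n
    show "((`) (\<phi>1 g) ^^ n) V = V \<longleftrightarrow> ((`) (\<phi>2 (\<Theta> g)) ^^ n) (h ` V) = h ` V"
      using funpow[OF g V, of n] himg[OF _ V, of "((`) (\<phi>1 g) ^^ n) V"] by simp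
  qed
  have sub1: "V \<subseteq> ?S" if "adapted X1 G1 \<phi>1 V" for V
    using that openin_subset unfolding adapted_def by blast
  have sub2: "\<exists>V. V \<subseteq> ?S \<and> W = h ` V" if "adapted X2 G2 \<phi>2 W" for W
  proof -
    have "W \<subseteq> h ` ?S"
      using that openin_subset img unfolding adapted_def by blast
    then show ?thesis by (auto simp: subset_image_iff)
  qed
  have "action_order X1 G1 \<phi>1 g = action_order X2 G2 \<phi>2 (\<Theta> g)" if g: "g \<in> carrier G1" for g
  proof -
    have "{least_period ((`) (\<phi>1 g)) V | V. adapted X1 G1 \<phi>1 V}
        = {least_period ((`) (\<phi>2 (\<Theta> g))) W | W. adapted X2 G2 \<phi>2 W}" (is "?L = ?R")
    proof (intro subset_antisym subsetI)
      fix n assume "n \<in> ?L"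
      then obtain V where V: "adapted X1 G1 \<phi>1 V" "n = least_period ((`) (\<phi>1 g)) V" by blast
      then have "adapted X2 G2 \<phi>2 (h ` V)" "n = least_period ((`) (\<phi>2 (\<Theta> g))) (h ` V)"
        using period[OF g sub1[OF V(1)]] adapted[OF sub1[OF V(1)]] by simp_all
      then show "n \<in> ?R" by blast
    next
      fix n assume "n \<in> ?R"
      then obtain W where W: "adapted X2 G2 \<phi>2 W" "n = least_period ((`) (\<phi>2 (\<Theta> g))) W" by blast
      obtain V where "V \<subseteq> ?S" "W = h ` V" using sub2[OF W(1)] by blast
      then have "adapted X1 G1 \<phi>1 V" "n = least_period ((`) (\<phi>1 g)) V"
        using W period[OF g] adapted by simp_all
      then show "n \<in> ?L" by blast
    qed
    then show ?thesis unfolding action_order_def by simp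
  qed
  then have "(\<lambda>g. steinitz_type (action_order X1 G1 \<phi>1 g)) ` carrier G1
      = (\<lambda>g. steinitz_type (action_order X2 G2 \<phi>2 g)) ` \<Theta> ` carrier G1"
    unfolding image_image by (intro image_cong) auto
  then show ?thesis unfolding action_typeset_def Setcompr_eq_image bij by simp
qed

section \<open>Adapted sets\<close>

context group_action
begin

lemma action_closed: "g \<in> carrier G \<Longrightarrow> x \<in> E \<Longrightarrow> \<phi> g x \<in> E"
  using element_image by blast

lemma action_funpow:
  assumes "g \<in> carrier G" "x \<in> E"
  shows "(\<phi> g ^^ n) x = \<phi> (g [^] n) x"
proof -
  interpret group G using group_hom group_hom.axioms(1) by auto
  show ?thesis
  proof (induction n)
    case 0
    \<comment> \<open>\<phi> sends \<open>\<one>\<close> to the identity restricted to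
      \<open>E\<close>, so it matters that \<open>x\<close> lies in \<open>E\<close>.\<close>
    show ?case using id_eq_one assms(2) by (metis funpow_0 nat_pow_0 restrict_apply')
  next
    case (Suc n)
    then show ?case
      using composition_rule[OF assms(2,1), of "g [^] n"] assms by (simp flip: nat_pow_Suc2)
  qed
qed

lemma image_action_funpow:
  assumes "g \<in> carrier G" "V \<subseteq> E"
  shows "((`) (\<phi> g) ^^ n) V = \<phi> (g [^] n) ` V"
  using assms action_funpow unfolding image_funpow by (intro image_cong) auto

end

text \<open>A power of \<open>g\<close> that fixes \<open>W\<close> moves \<open>V\<close> to a set
  still meeting \<open>V\<close> in \<open>W\<close>, so it fixes the adapted set \<open>V\<close>.
  Hence each return time of \<open>W\<close> is one of \<open>V\<close>.\<close>

lemma least_period_dvd_if_subset: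
  assumes act: "group_action G (topspace X) \<phi>" and g: "g \<in> carrier G"
    and V: "adapted X G \<phi> V" and W: "adapted X G \<phi> W" and sub: "W \<subseteq> V"
    and per: "periodic ((`) (\<phi> g)) V" "periodic ((`) (\<phi> g)) W"
  shows "least_period ((`) (\<phi> g)) V dvd least_period ((`) (\<phi> g)) W"
proof -
  interpret group_action G "topspace X" \<phi> by fact
  interpret group G using group_hom group_hom.axioms(1) by auto
  define n where "n = least_period ((`) (\<phi> g)) W"
  have sets: "V \<subseteq> topspace X" "W \<subseteq> topspace X" "W \<noteq> {}"
    using V W openin_subset unfolding adapted_def by blast+
  have "\<phi> (g [^]\<^bsub>G\<^esub> n) ` W = W"
    using least_period_props(2)[OF per(2)] image_action_funpow[OF g sets(2)] unfolding n_def by simp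
  then have "\<phi> (g [^]\<^bsub>G\<^esub> n) ` V \<inter> V \<noteq> {}"
    using sets(3) sub by blast
  then have "\<phi> (g [^]\<^bsub>G\<^esub> n) ` V = V"
    using V nat_pow_closed[OF g] unfolding adapted_def by blast
  then show ?thesis
    using funpow_eq_iff_least_period_dvd[OF per(1)] image_action_funpow[OF g sets(1)] unfolding n_def by simp
qed

section \<open>The return action on an adapted set\<close>

lemma return_subgroup_image:
  assumes "adapted X G \<phi> U" "g \<in> return_subgroup G \<phi> U"
  shows "g \<in> carrier G" "\<phi> g ` U = U"
  using assms unfolding adapted_def return_subgroup_def by auto

lemma carrier_return_group:
  "carrier (return_group G \<phi> U) = (\<lambda>g. restrict (\<phi> g) U) ` return_subgroup G \<phi> U"
  by (simp add: return_group_def)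

text \<open>An element that moves a subset \<open>V\<close> of \<open>U\<close> to a set meeting
  \<open>V\<close> also moves \<open>U\<close> to a set meeting \<open>U\<close>, so it lies in the
  return subgroup. As \<open>U\<close> is clopen, clopen in \<open>U\<close> means clopen in
  \<open>X\<close> and contained in \<open>U\<close>.\<close>

lemma adapted_return_group_iff:
  assumes U: "adapted X G \<phi> U"
  shows "adapted (subtopology X U) (return_group G \<phi> U) (\<lambda>f. f) V \<longleftrightarrow> adapted X G \<phi> V \<and> V \<subseteq> U"
proof (cases "V \<subseteq> U")
  case True
  have img: "restrict (\<phi> g) U ` V = \<phi> g ` V" for g
    using True by (intro image_cong) auto
  have "g \<in> return_subgroup G \<phi> U" if "g \<in> carrier G" "\<phi> g ` V \<inter> V \<noteq> {}" for g
    using that True unfolding return_subgroup_def by blast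
  then have "(\<forall>g\<in>return_subgroup G \<phi> U. \<phi> g ` V \<inter> V \<noteq> {} \<longrightarrow> \<phi> g ` V = V)
      \<longleftrightarrow> (\<forall>g\<in>carrier G. \<phi> g ` V \<inter> V \<noteq> {} \<longrightarrow> \<phi> g ` V = V)"
    unfolding return_subgroup_def by blast
  moreover have "openin X U" "closedin X U" using U unfolding adapted_def by auto
  ultimately show ?thesis
    using True unfolding adapted_def carrier_return_group
    by (simp only: ball_simps img openin_open_subtopology closedin_closed_subtopology) simp
next
  case False
  then have "\<not> openin (subtopology X U) V"
    using openin_subset by fastforce
  then show ?thesis using False unfolding adapted_def by blast
qed

text \<open>All iterated images of \<open>V\<close> stay in \<open>U\<close>, where the two maps
  agree; the induction carries this containment along.\<close>

lemma least_period_restrict: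
  assumes "f ` U \<subseteq> U" "V \<subseteq> U"
  shows "least_period ((`) (restrict f U)) V = least_period ((`) f) V"
proof -
  have "((`) (restrict f U) ^^ n) V = ((`) f ^^ n) V \<and> ((`) f ^^ n) V \<subseteq> U" for n
  proof (induction n)
    case (Suc n)
    let ?W = "((`) f ^^ n) V"
    have "restrict f U ` ?W = f ` ?W"
      using Suc by (intro image_cong) auto
    moreover have "f ` ?W \<subseteq> U"
      using Suc assms(1) by blast
    ultimately show ?case using Suc by (simp del: image_restrict_eq)
  qed (use assms(2) in simp)
  then show ?thesis by (intro least_period_cong) simp
qed

section \<open>Cylinder sets of a group chain model\<close>

text \<open>\<open>C\<close> and \<open>h\<close> form an arbitrary model, because the chain in
  \<open>typeset\<close> is given only by a choice operator. The assumption \<open>nonempty\<close>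
  supplies a point around which cylinders can be taken.\<close>

locale abelian_chain_model = comm_group G + group_action G "topspace X" \<phi>
  for G :: "('g, 'm) monoid_scheme" (structure) and X :: "'x topology" and \<phi> +
  fixes C :: "nat \<Rightarrow> 'g set" and h :: "'x \<Rightarrow> nat \<Rightarrow> 'g set"
  assumes chain: "group_chain G C"
    and homeo: "homeomorphic_map X (chain_limit G C) h"
    and equivariant: "\<And>g x. g \<in> carrier G \<Longrightarrow> x \<in> topspace X \<Longrightarrow> h (\<phi> g x) = chain_action G g (h x)"
    and nonempty: "topspace X \<noteq> {}"
begin

definition cylinder :: "nat \<Rightarrow> 'x \<Rightarrow> 'x set" where
  "cylinder l x = {y \<in> topspace X. h y l = h x l}"

lemma chain_subgroup: "subgroup (C l) G"
  and finite_chain_cosets: "finite (lcosets (C l))"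
  using chain unfolding group_chain_def by auto

lemma in_chain_limit:
  assumes "x \<in> topspace X"
  shows "h x l \<in> lcosets (C l)" "h x (Suc l) <#> C l = h x l"
proof -
  have "h x \<in> topspace (chain_limit G C)"
    using homeomorphic_imp_surjective_map[OF homeo] assms by blast
  then show "h x l \<in> lcosets (C l)" "h x (Suc l) <#> C l = h x l"
    unfolding chain_limit_def by auto
qed

lemma self_in_cylinder: "x \<in> topspace X \<Longrightarrow> x \<in> cylinder l x"
  by (simp add: cylinder_def)

text \<open>Coordinate \<open>l\<close> determines all lower ones, since the bonding maps send
  \<open>h x (Suc n)\<close> to \<open>h x n\<close>.\<close>

lemma cylinder_antimono:
  assumes "x \<in> topspace X" "k \<le> l"
  shows "cylinder l x \<subseteq> cylinder k x"
  using assms(2)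
proof (induction rule: dec_induct)
  case (step n)
  have "cylinder (Suc n) x \<subseteq> cylinder n x"
  proof
    fix y assume "y \<in> cylinder (Suc n) x"
    then show "y \<in> cylinder n x"
      using in_chain_limit(2)[of x n] in_chain_limit(2)[of y n] assms(1)
      by (simp add: cylinder_def)
  qed
  then show ?case using step by blast
qed simp

text \<open>The stabilizer of a coset \<open>a <# C l\<close> is the conjugate of \<open>C l\<close>
  by \<open>a\<close>, which is \<open>C l\<close> itself by commutativity.\<close>

lemma coset_mult_eq_iff:
  assumes A: "A \<in> lcosets (C l)" and g: "g \<in> carrier G"
  shows "g <#\<^bsub>G\<^esub> A = A \<longleftrightarrow> g \<in> C l"
proof -
  interpret H: subgroup "C l" G by (rule chain_subgroup)
  obtain a where a: "a \<in> carrier G" "A = a <#\<^bsub>G\<^esub> C l"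
    using A unfolding LCOSETS_def by blast
  have ga: "g <#\<^bsub>G\<^esub> A = (g \<otimes> a) <#\<^bsub>G\<^esub> C l"
    using a g by (simp add: lcos_m_assoc H.subset)
  show ?thesis
  proof
    assume "g <#\<^bsub>G\<^esub> A = A"
    then have "g \<otimes> a \<in> a <#\<^bsub>G\<^esub> C l"
      using lcos_self[OF _ chain_subgroup, of "g \<otimes> a"] a g ga by simp
    then have "inv a \<otimes> (g \<otimes> a) \<in> C l"
      using H.lcos_module_imp[OF is_group] a g by simp
    moreover have "inv a \<otimes> (g \<otimes> a) = g"
      using a g by (simp add: m_comm[of g a] m_assoc[symmetric])
    ultimately show "g \<in> C l" by simp
  next
    assume "g \<in> C l"
    moreover have "g \<otimes> a = a \<otimes> g" using a g by (simp add: m_comm)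
    ultimately have "g \<otimes> a \<in> a <#\<^bsub>G\<^esub> C l" unfolding l_coset_def by auto
    then show "g <#\<^bsub>G\<^esub> A = A"
      unfolding ga using l_repr_independence[OF _ a(1) chain_subgroup] a(2) by simp
  qed
qed

lemma image_cylinder:
  assumes x: "x \<in> topspace X" and g: "g \<in> carrier G"
  shows "\<phi> g ` cylinder l x = {y \<in> topspace X. h y l = g <#\<^bsub>G\<^esub> h x l}"
proof (intro subset_antisym subsetI)
  fix z assume "z \<in> \<phi> g ` cylinder l x"
  then show "z \<in> {y \<in> topspace X. h y l = g <#\<^bsub>G\<^esub> h x l}"
    using g action_closed by (auto simp: cylinder_def equivariant chain_action_def)
next
  fix z assume "z \<in> {y \<in> topspace X. h y l = g <#\<^bsub>G\<^esub> h x l}"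
  then have z: "z \<in> topspace X" "h z l = g <#\<^bsub>G\<^esub> h x l" by auto
  have sub: "h x l \<subseteq> carrier G"
    using subgroup.lcosets_carrier[OF chain_subgroup is_group in_chain_limit(1)[OF x]] .
  let ?y = "\<phi> (inv g) z"
  have y: "?y \<in> topspace X" using z(1) g action_closed by simp
  have "h ?y l = inv g <#\<^bsub>G\<^esub> (g <#\<^bsub>G\<^esub> h x l)"
    using z g equivariant[of "inv g" z] by (simp add: chain_action_def)
  then have "h ?y l = h x l"
    using g sub by (simp add: lcos_m_assoc lcos_mult_one)
  moreover have "\<phi> g ?y = z"
    using orbit_sym_aux[of "inv g" z ?y] g z(1) by simp
  ultimately show "z \<in> \<phi> g ` cylinder l x"
    using y unfolding cylinder_def by (intro image_eqI[of z _ ?y]) auto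
qed

text \<open>Cylinders of one level over different cosets are disjoint, so a translate that meets the
  cylinder lies over the same coset, and \<open>g\<close> stabilizes this coset.\<close>

lemma image_cylinder_eq_iff:
  assumes x: "x \<in> topspace X" and g: "g \<in> carrier G"
  shows "\<phi> g ` cylinder l x = cylinder l x \<longleftrightarrow> g \<in> C l"
    and "\<phi> g ` cylinder l x \<inter> cylinder l x \<noteq> {} \<longleftrightarrow> g \<in> C l"
proof -
  have stable: "\<phi> g ` cylinder l x = cylinder l x" if "g \<in> C l"
    using image_cylinder[OF assms, of l] coset_mult_eq_iff[OF in_chain_limit(1)[OF x] g, of l] that
    by (simp add: cylinder_def)
  have "g \<in> C l" if "y \<in> \<phi> g ` cylinder l x \<inter> cylinder l x" for y
  proof -
    have "h y l = g <#\<^bsub>G\<^esub> h x l" "h y l = h x l"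
      using that unfolding image_cylinder[OF assms] unfolding cylinder_def by blast+
    then have "g <#\<^bsub>G\<^esub> h x l = h x l" by (rule trans[OF sym])
    then show ?thesis using coset_mult_eq_iff[OF in_chain_limit(1)[OF x] g, of l] by simp
  qed
  then show "\<phi> g ` cylinder l x = cylinder l x \<longleftrightarrow> g \<in> C l"
    and "\<phi> g ` cylinder l x \<inter> cylinder l x \<noteq> {} \<longleftrightarrow> g \<in> C l"
    using stable self_in_cylinder[OF x, of l] by blast+
qed

text \<open>Coordinate \<open>l\<close> is a continuous map to a discrete space, so the cylinder is
  clopen as the preimage of a point. Meeting the translate and being equal to it are both equivalent
  to \<open>g\<close> lying in \<open>C l\<close>.\<close>

lemma adapted_cylinder:
  assumes x: "x \<in> topspace X"
  shows "adapted X G \<phi> (cylinder l x)"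
proof -
  have "continuous_map X (chain_limit G C) h"
    using homeo by (rule homeomorphic_imp_continuous_map)
  then have "continuous_map X (product_topology (\<lambda>l. discrete_topology (lcosets (C l))) UNIV) h"
    unfolding chain_limit_def continuous_map_in_subtopology by simp
  then have cont: "continuous_map X (discrete_topology (lcosets (C l))) (\<lambda>y. h y l)"
    by (simp add: continuous_map_componentwise_UNIV)
  have "openin X {y \<in> topspace X. h y l \<in> {h x l}}" "closedin X {y \<in> topspace X. h y l \<in> {h x l}}"
    using in_chain_limit(1)[OF x, of l]
    by (intro openin_continuous_map_preimage[OF cont] closedin_continuous_map_preimage[OF cont];
        simp)+
  then have "openin X (cylinder l x)" "closedin X (cylinder l x)"
    by (simp_all add: cylinder_def)
  moreover have "cylinder l x \<noteq> {}" using self_in_cylinder[OF x] by blast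
  ultimately show ?thesis
    unfolding adapted_def using image_cylinder_eq_iff[OF x] by simp
qed

text \<open>A basic open set of the product restricts only finitely many coordinates, and all of
  these are determined by coordinate \<open>l\<close> once \<open>l\<close> is an upper bound for
  their indices.\<close>

lemma cylinder_subset_open:
  assumes V: "openin X V" and x: "x \<in> V"
  shows "\<exists>l. cylinder l x \<subseteq> V"
proof -
  let ?P = "product_topology (\<lambda>l. discrete_topology (lcosets (C l))) UNIV"
  have VX: "V \<subseteq> topspace X" using V by (rule openin_subset)
  have inj: "inj_on h (topspace X)" using homeo by (rule homeomorphic_imp_injective_map)
  have "openin (chain_limit G C) (h ` V)"
    using homeomorphic_map_openness[OF homeo VX] V by simp
  then obtain T where T: "openin ?P T" "h ` V = T \<inter> {A. \<forall>l. A (Suc l) <#> C l = A l}"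
    unfolding chain_limit_def openin_subtopology by blast
  have "h x \<in> T" using T(2) x by blast
  with T(1) obtain U where U: "finite {i. U i \<noteq> lcosets (C i)}" "h x \<in> Pi\<^sub>E UNIV U" "Pi\<^sub>E UNIV U \<subseteq> T"
    unfolding openin_product_topology_alt by auto
  then obtain l where "\<forall>i\<in>{i. U i \<noteq> lcosets (C i)}. i \<le> l"
    unfolding finite_nat_set_iff_bounded_le by blast
  then have l: "\<And>i. U i \<noteq> lcosets (C i) \<Longrightarrow> i \<le> l" by simp
  have "y \<in> V" if y: "y \<in> cylinder l x" for y
  proof -
    have yX: "y \<in> topspace X" using y by (simp add: cylinder_def)
    have "h y i \<in> U i" for i
    proof (cases "i \<le> l")
      case True
      then have "y \<in> cylinder i x" using y cylinder_antimono x VX by blast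
      then have "h y i = h x i" by (simp add: cylinder_def)
      then show ?thesis using U(2) by (simp add: PiE_iff)
    next
      case False
      then have "U i = lcosets (C i)" using l by blast
      then show ?thesis using in_chain_limit(1)[OF yX] by simp
    qed
    then have "h y \<in> Pi\<^sub>E UNIV U" by (simp add: PiE_iff)
    then have "h y \<in> T" using U(3) by blast
    then have "h y \<in> h ` V" unfolding T(2) using in_chain_limit(2)[OF yX] by simp
    then show ?thesis using inj_on_image_mem_iff[OF inj yX VX] by simp
  qed
  then show ?thesis by blast
qed

section \<open>Periods of cylinders and of adapted sets\<close>

lemma action_funpow_cylinder_iff:
  assumes "x \<in> topspace X" "g \<in> carrier G"
  shows "((`) (\<phi> g) ^^ n) (cylinder l x) = cylinder l x \<longleftrightarrow> g [^] n \<in> C l"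
proof -
  have "cylinder l x \<subseteq> topspace X" unfolding cylinder_def by blast
  then show ?thesis
    using image_action_funpow[OF assms(2)] image_cylinder_eq_iff(1)[OF assms(1)] assms(2) by simp
qed

lemma periodic_cylinder:
  assumes "x \<in> topspace X" "g \<in> carrier G"
  shows "periodic ((`) (\<phi> g)) (cylinder l x)"
  unfolding periodic_def action_funpow_cylinder_iff[OF assms]
  by (rule power_in_finite_index_subgroup[OF chain_subgroup finite_chain_cosets assms(2)])

text \<open>Both sides are the least positive \<open>n\<close> with \<open>g [^] n\<close> in
  \<open>C l\<close>.\<close>

lemma cyclic_index_normal_core:
  assumes "x \<in> topspace X" "g \<in> carrier G"
  shows "cyclic_index G g (normal_core G (C l)) = least_period ((`) (\<phi> g)) (cylinder l x)"
  unfolding normal_core_eq[OF chain_subgroup] least_period_def action_funpow_cylinder_iff[OF assms]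
  by (rule cyclic_index_eq[OF chain_subgroup assms(2)
        power_in_finite_index_subgroup[OF chain_subgroup finite_chain_cosets assms(2)]])

text \<open>Some positive power of \<open>g\<close> lies in \<open>C l\<close> for a cylinder of
  level \<open>l\<close> inside \<open>V\<close>. It fixes this cylinder, hence moves
  \<open>V\<close> to a set meeting \<open>V\<close>, hence fixes \<open>V\<close>.\<close>

lemma periodic_adapted:
  assumes V: "adapted X G \<phi> V" and g: "g \<in> carrier G"
  shows "periodic ((`) (\<phi> g)) V"
proof -
  have VX: "V \<subseteq> topspace X" and "V \<noteq> {}"
    using V openin_subset unfolding adapted_def by auto
  then obtain x where x: "x \<in> V" by blast
  then obtain l where l: "cylinder l x \<subseteq> V"
    using cylinder_subset_open V unfolding adapted_def by blast
  obtain n :: nat where n: "0 < n" "g [^] n \<in> C l"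
    using power_in_finite_index_subgroup[OF chain_subgroup finite_chain_cosets g] by blast
  have "\<phi> (g [^] n) ` cylinder l x = cylinder l x"
    using n(2) image_cylinder_eq_iff(1) x VX g by blast
  then have "\<phi> (g [^] n) ` V \<inter> V \<noteq> {}"
    using l self_in_cylinder[of x l] x VX by blast
  then have "\<phi> (g [^] n) ` V = V"
    using V g unfolding adapted_def by simp
  then show ?thesis
    using n(1) image_action_funpow[OF g VX, of n] unfolding periodic_def by auto
qed

text \<open>Cylinders around a point of \<open>V\<close> are contained in \<open>V\<close> from
  level \<open>k\<close> on. The bound holds for cylinders around any \<open>x\<close>, even far
  from \<open>V\<close>, because the period of a cylinder depends only on its level.\<close>

lemma least_period_dvd_cylinder:
  assumes V: "adapted X G \<phi> V" and g: "g \<in> carrier G"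
  shows "\<exists>k. \<forall>l\<ge>k. \<forall>x\<in>topspace X.
    least_period ((`) (\<phi> g)) V dvd least_period ((`) (\<phi> g)) (cylinder l x)"
proof -
  have VX: "V \<subseteq> topspace X" and "V \<noteq> {}"
    using V openin_subset unfolding adapted_def by auto
  then obtain y where y: "y \<in> V" by blast
  then obtain k where k: "cylinder k y \<subseteq> V"
    using cylinder_subset_open V unfolding adapted_def by blast
  have yX: "y \<in> topspace X" using y VX by blast
  have "least_period ((`) (\<phi> g)) V dvd least_period ((`) (\<phi> g)) (cylinder l x)"
    if l: "k \<le> l" and x: "x \<in> topspace X" for l x
  proof -
    have "least_period ((`) (\<phi> g)) V dvd least_period ((`) (\<phi> g)) (cylinder l y)"
      using cylinder_antimono[OF yX l] k V adapted_cylinder[OF yX] g periodic_adapted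
      by (intro least_period_dvd_if_subset[OF group_action_axioms]) auto
    also have "least_period ((`) (\<phi> g)) (cylinder l y) = least_period ((`) (\<phi> g)) (cylinder l x)"
      by (intro least_period_cong) (simp add: action_funpow_cylinder_iff x yX g)
    finally show ?thesis .
  qed
  then show ?thesis by blast
qed

section \<open>Independence of the typeset from the chain\<close>

lemma steinitz_order_eq_action_order:
  assumes g: "g \<in> carrier G"
  shows "steinitz_order G C g = action_order X G \<phi> g"
proof -
  obtain x where x: "x \<in> topspace X" using nonempty by blast
  let ?p = "\<lambda>V. least_period ((`) (\<phi> g)) V"
  have idx: "cyclic_index G g (normal_core G (C l)) = ?p (cylinder l x)" for l
    by (rule cyclic_index_normal_core[OF x g])
  have "steinitz_lcm {?p V | V. adapted X G \<phi> V} = steinitz_lcm {?p (cylinder l x) | l. l > 0}"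
  proof (rule steinitz_lcm_cofinal)
    show "{?p (cylinder l x) | l. l > 0} \<subseteq> {?p V | V. adapted X G \<phi> V}"
      using adapted_cylinder[OF x] by blast
  next
    fix a assume "a \<in> {?p V | V. adapted X G \<phi> V}"
    then obtain V where V: "adapted X G \<phi> V" "a = ?p V" by blast
    then obtain k where "\<forall>l\<ge>k. \<forall>x\<in>topspace X. ?p V dvd ?p (cylinder l x)"
      using least_period_dvd_cylinder[OF _ g] by blast
    \<comment> \<open>Level \<open>Suc k\<close> is taken instead of \<open>k\<close> because the
      least common multiple defining the Steinitz order runs over positive levels.\<close>
    then have "a dvd ?p (cylinder (Suc k) x)" using V(2) x by simp
    then show "\<exists>b\<in>{?p (cylinder l x) | l. l > 0}. a dvd b" by blast
  next
    fix b assume "b \<in> {?p (cylinder l x) | l. l > 0}"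
    then show "0 < b" using least_period_props(1)[OF periodic_cylinder[OF x g]] by blast
  qed
  then show ?thesis
    unfolding steinitz_order_def action_order_def idx by simp
qed

lemma chain_typeset_eq_action_typeset: "chain_typeset G C = action_typeset X G \<phi>"
  unfolding chain_typeset_def action_typeset_def Setcompr_eq_image
  by (intro image_cong) (simp_all add: steinitz_order_eq_action_order)

section \<open>Passage from the action to its return action\<close>

lemma action_order_eq_return_group:
  assumes U: "adapted X G \<phi> U" and g: "g \<in> carrier G"
  defines "m \<equiv> least_period ((`) (\<phi> g)) U"
  shows "g [^] m \<in> return_subgroup G \<phi> U"
    and "action_order X G \<phi> g = steinitz_mult (steinitz_of_nat m)
      (action_order (subtopology X U) (return_group G \<phi> U) (\<lambda>f. f) (restrict (\<phi> (g [^] m)) U))"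
proof -
  let ?p = "\<lambda>V. least_period ((`) (\<phi> g)) V"
  let ?f = "restrict (\<phi> (g [^] m)) U"
  have UX: "U \<subseteq> topspace X" and Une: "U \<noteq> {}" and Uo: "openin X U"
    using U openin_subset unfolding adapted_def by auto
  have m: "0 < m" "((`) (\<phi> g) ^^ m) U = U"
    unfolding m_def using least_period_props[OF periodic_adapted[OF U g]] by auto
  then have img: "\<phi> (g [^] m) ` U = U"
    using image_action_funpow[OF g UX] by simp
  then show "g [^] m \<in> return_subgroup G \<phi> U"
    using g Une unfolding return_subgroup_def by simp
  \<comment> \<open>Since \<open>V\<close> is contained in \<open>U\<close>, its period is a
    multiple of \<open>m\<close>. Iterating in steps of \<open>m\<close> divides the period by
    \<open>m\<close>, and on \<open>U\<close> the power \<open>g [^] m\<close> agrees with its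
    restriction \<open>?f\<close>.\<close>
  have split: "?p V = m * least_period ((`) ?f) V"
    if V: "adapted X G \<phi> V" "V \<subseteq> U" for V
  proof -
    have VX: "V \<subseteq> topspace X" using V(2) UX by blast
    have "m dvd ?p V"
      unfolding m_def using V U g periodic_adapted
      by (intro least_period_dvd_if_subset[OF group_action_axioms]) auto
    note per = least_period_funpow[OF periodic_adapted[OF V(1) g] this]
    have pow: "(((`) (\<phi> g) ^^ m) ^^ n) V = ((`) (\<phi> (g [^] m)) ^^ n) V" for n
      using image_action_funpow[OF g VX, of "m * n"] image_action_funpow[OF nat_pow_closed[OF g] VX]
        nat_pow_pow[OF g] by (simp add: funpow_mult)
    have "least_period ((`) (\<phi> g) ^^ m) V = least_period ((`) (\<phi> (g [^] m))) V"
      using pow by (intro least_period_cong) simp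
    also have "\<dots> = least_period ((`) ?f) V"
      using img V(2) by (intro least_period_restrict[symmetric]) auto
    finally show ?thesis using per(2) by simp
  qed
  let ?A = "{V. adapted X G \<phi> V}" and ?B = "{V. adapted X G \<phi> V \<and> V \<subseteq> U}"
  have pos: "0 < ?p V" if "adapted X G \<phi> V" for V
    using least_period_props(1)[OF periodic_adapted[OF that g]] .
  have "steinitz_lcm (?p ` ?A) = steinitz_lcm (?p ` ?B)"
  proof (rule steinitz_lcm_cofinal)
    fix a assume "a \<in> ?p ` ?A"
    then obtain V where V: "adapted X G \<phi> V" "a = ?p V" by blast
    obtain k where k: "\<forall>l\<ge>k. \<forall>x\<in>topspace X. ?p V dvd ?p (cylinder l x)"
      using least_period_dvd_cylinder[OF V(1) g] by blast
    obtain x where x: "x \<in> U" using Une by blast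
    then have xX: "x \<in> topspace X" using UX by blast
    obtain l where l: "cylinder l x \<subseteq> U" using cylinder_subset_open[OF Uo x] by blast
    \<comment> \<open>Level \<open>k\<close> makes the period a multiple of that of
      \<open>V\<close>, although \<open>V\<close> may be disjoint from \<open>U\<close>; level
      \<open>l\<close> puts the cylinder inside \<open>U\<close>.\<close>
    let ?W = "cylinder (max k l) x"
    have "?W \<in> ?B"
      using adapted_cylinder[OF xX] cylinder_antimono[OF xX, of l "max k l"] l by auto
    moreover have "a dvd ?p ?W" using k V(2) xX by simp
    ultimately show "\<exists>b\<in>?p ` ?B. a dvd b" by blast
  qed (use pos in auto)
  also have "?p ` ?B = (*) m ` (\<lambda>V. least_period ((`) ?f) V) ` ?B"
    unfolding image_image using split by (intro image_cong) auto
  also have "steinitz_lcm \<dots> = steinitz_mult (steinitz_of_nat m)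
      (steinitz_lcm ((\<lambda>V. least_period ((`) ?f) V) ` ?B))"
  proof (rule steinitz_lcm_mult)
    show "(\<lambda>V. least_period ((`) ?f) V) ` ?B \<noteq> {}" using U by blast
    fix a assume "a \<in> (\<lambda>V. least_period ((`) ?f) V) ` ?B"
    then obtain V where V: "adapted X G \<phi> V" "V \<subseteq> U" "a = least_period ((`) ?f) V" by blast
    then have "0 < m * a" using split[OF V(1,2)] pos[OF V(1)] by simp
    then show "0 < a" by simp
  qed (rule m(1))
  finally show "action_order X G \<phi> g = steinitz_mult (steinitz_of_nat m)
      (action_order (subtopology X U) (return_group G \<phi> U) (\<lambda>f. f) ?f)"
    unfolding action_order_def adapted_return_group_iff[OF U] setcompr_eq_image .
qed

lemma action_typeset_eq_return_group:
  assumes U: "adapted X G \<phi> U"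
  shows "action_typeset X G \<phi> = action_typeset (subtopology X U) (return_group G \<phi> U) (\<lambda>f. f)"
proof -
  let ?o = "action_order (subtopology X U) (return_group G \<phi> U) (\<lambda>f. f)"
  have type: "steinitz_type (action_order X G \<phi> g)
      = steinitz_type (?o (restrict (\<phi> (g [^] least_period ((`) (\<phi> g)) U)) U))"
    if g: "g \<in> carrier G" for g
    unfolding action_order_eq_return_group(2)[OF U g]
    using least_period_props(1)[OF periodic_adapted[OF U g]]
    by (intro steinitz_type_mult) (simp_all add: action_order_def steinitz_lcm_in_steinitz_numbers)
  show ?thesis
  proof (intro subset_antisym subsetI)
    fix t assume "t \<in> action_typeset X G \<phi>"
    then obtain g where g: "g \<in> carrier G" "t = steinitz_type (action_order X G \<phi> g)"
      unfolding action_typeset_def by blast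
    show "t \<in> action_typeset (subtopology X U) (return_group G \<phi> U) (\<lambda>f. f)"
      unfolding action_typeset_def carrier_return_group g(2) type[OF g(1)]
      using action_order_eq_return_group(1)[OF U g(1)] by blast
  next
    fix t assume "t \<in> action_typeset (subtopology X U) (return_group G \<phi> U) (\<lambda>f. f)"
    then obtain g where g: "g \<in> return_subgroup G \<phi> U" "t = steinitz_type (?o (restrict (\<phi> g) U))"
      unfolding action_typeset_def carrier_return_group by blast
    note img = return_subgroup_image[OF U g(1)]
    have "((`) (\<phi> g) ^^ 1) U = U" using img(2) by simp
    \<comment> \<open>An element of the return subgroup already preserves \<open>U\<close>, so the
      exponent in \<open>type\<close> is 1 and the restriction of \<open>g\<close> itself appears
      there.\<close>
    then have "least_period ((`) (\<phi> g)) U = 1"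
      using funpow_eq_iff_least_period_dvd[OF periodic_adapted[OF U img(1)], of 1] by simp
    then have "t = steinitz_type (action_order X G \<phi> g)"
      unfolding g(2) type[OF img(1)] using img(1) by simp
    then show "t \<in> action_typeset X G \<phi>"
      unfolding action_typeset_def using img(1) by blast
  qed
qed

end

section \<open>Existence of group chain models\<close>

text \<open>Below, \<open>c\<close> is the coordinate map of the Cantor space. The class \<open>cls l x\<close> consists of the points
  that have the same first \<open>l\<close> coordinates as \<open>x\<close> along the whole orbit. Equicontinuity makes it open,
  and the translates of a class are again classes, so the classes are adapted sets. The chain
  is given by their stabilizers at the base point, and \<open>code x l\<close> is the coset of the elements
  that move the base point into \<open>cls l x\<close>.\<close>

locale odometer_coding = group G + group_action G "topspace X" \<phi>
  for G :: "('g, 'm) monoid_scheme" (structure) and X :: "'x topology" and \<phi> +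
  fixes c :: "'x \<Rightarrow> nat \<Rightarrow> bool" and base :: 'x
  assumes compact: "compact_space X"
    and minimal: "minimal_action X G \<phi>"
    and inj_c: "inj_on c (topspace X)"
    and base: "base \<in> topspace X"
    and open_agree: "\<And>x i. x \<in> topspace X \<Longrightarrow>
      openin X {y \<in> topspace X. \<forall>g\<in>carrier G. c (\<phi> g y) i = c (\<phi> g x) i}"
begin

definition cls :: "nat \<Rightarrow> 'x \<Rightarrow> 'x set" where
  "cls l x = {y \<in> topspace X. \<forall>g\<in>carrier G. \<forall>i<l. c (\<phi> g y) i = c (\<phi> g x) i}"

definition stab :: "nat \<Rightarrow> 'g set" where
  "stab l = {g \<in> carrier G. \<phi> g base \<in> cls l base}"

definition code :: "'x \<Rightarrow> nat \<Rightarrow> 'g set" where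
  "code x l = {g \<in> carrier G. \<phi> g base \<in> cls l x}"

section \<open>Invariant finite partitions into open classes\<close>

lemma cls_self: "x \<in> topspace X \<Longrightarrow> x \<in> cls l x"
  by (simp add: cls_def)

lemma cls_eq: "y \<in> cls l x \<Longrightarrow> cls l y = cls l x"
  by (simp add: cls_def)

lemma cls_Suc: "cls (Suc l) x \<subseteq> cls l x"
  by (auto simp: cls_def)

text \<open>Classes compare points along whole orbits, and applying \<open>k\<close> after
  \<open>g\<close> is applying \<open>k \<otimes> g\<close>.\<close>

lemma cls_act:
  assumes "y \<in> cls l x" "g \<in> carrier G" "x \<in> topspace X"
  shows "\<phi> g y \<in> cls l (\<phi> g x)"
proof -
  have y: "y \<in> topspace X" using assms(1) by (simp add: cls_def)
  have "c (\<phi> k (\<phi> g y)) i = c (\<phi> k (\<phi> g x)) i" if "k \<in> carrier G" "i < l" for k i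
  proof -
    have "c (\<phi> (k \<otimes> g) y) i = c (\<phi> (k \<otimes> g) x) i"
      using assms(1,2) that by (simp add: cls_def)
    then show ?thesis
      using composition_rule[OF y that(1) assms(2)] composition_rule[OF assms(3) that(1) assms(2)]
      by simp
  qed
  then show ?thesis using action_closed[OF assms(2) y] by (simp add: cls_def)
qed

lemma cls_act_iff:
  assumes "g \<in> carrier G" "x \<in> topspace X" "y \<in> topspace X"
  shows "\<phi> g y \<in> cls l (\<phi> g x) \<longleftrightarrow> y \<in> cls l x"
  using cls_act[OF _ assms(1,2), of y l] cls_act[of "\<phi> g y" l "\<phi> g x" "inv g"] assms
    orbit_sym_aux[OF assms(1,2)] orbit_sym_aux[OF assms(1,3)] action_closed[OF assms(1,2)] by auto

lemma openin_cls:
  assumes "x \<in> topspace X"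
  shows "openin X (cls l x)"
proof (induction l)
  case (Suc l)
  have "cls (Suc l) x
      = cls l x \<inter> {y \<in> topspace X. \<forall>g\<in>carrier G. c (\<phi> g y) l = c (\<phi> g x) l}"
    by (auto simp: cls_def less_Suc_eq)
  then show ?case using openin_Int[OF Suc open_agree[OF assms, of l]] by simp
qed (simp add: cls_def)

text \<open>The classes partition a compact space into open sets, so a finite subcover has to
  contain every class.\<close>

lemma finite_cls: "finite (cls l ` topspace X)"
proof -
  have "\<forall>U\<in>cls l ` topspace X. openin X U" using openin_cls by blast
  moreover have "topspace X \<subseteq> \<Union> (cls l ` topspace X)" using cls_self by blast
  ultimately have "\<exists>F. finite F \<and> F \<subseteq> cls l ` topspace X \<and> topspace X \<subseteq> \<Union> F"
    by (intro compact[unfolded compact_space_alt, rule_format]) simp_all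
  then obtain F where F: "finite F" "F \<subseteq> cls l ` topspace X" "topspace X \<subseteq> \<Union> F"
    by blast
  have "cls l x \<in> F" if "x \<in> topspace X" for x
  proof -
    obtain S where S: "S \<in> F" "x \<in> S" using F(3) \<open>x \<in> topspace X\<close> by blast
    then obtain y where "S = cls l y" using F(2) by blast
    then show ?thesis using S cls_eq[of x l y] by simp
  qed
  then have "cls l ` topspace X \<subseteq> F" by blast
  then show ?thesis using F(1) finite_subset by blast
qed

text \<open>By minimality the orbit of the base point is dense, so it meets the open class of
  \<open>x\<close>.\<close>

lemma code_nonempty:
  assumes "x \<in> topspace X"
  shows "\<exists>g. g \<in> code x l"
proof -
  have "x \<in> X closure_of (orbit G \<phi> base)"
    using minimal base assms unfolding minimal_action_def by simp
  then obtain y where "y \<in> orbit G \<phi> base" "y \<in> cls l x"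
    unfolding in_closure_of using openin_cls[OF assms] cls_self[OF assms] by blast
  then show ?thesis unfolding orbit_def code_def by blast
qed

section \<open>Stabilizers of the classes and their cosets\<close>

lemma act_base_in_cls_iff:
  assumes "g \<in> carrier G" "k \<in> carrier G"
  shows "\<phi> k base \<in> cls l (\<phi> g base) \<longleftrightarrow> inv g \<otimes> k \<in> stab l"
proof -
  have "\<phi> g (\<phi> (inv g \<otimes> k) base) = \<phi> k base"
    using composition_rule[OF base assms(1), of "inv g \<otimes> k"] assms by (simp add: m_assoc[symmetric])
  then show ?thesis
    using cls_act_iff[OF assms(1) base, of "\<phi> (inv g \<otimes> k) base" l] action_closed base assms
    by (simp add: stab_def)
qed

text \<open>For \<open>a\<close> in the stabilizer, \<open>base\<close> and its image under
  \<open>a\<close> have the same class. Inverses and products are then the cases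
  \<open>k = \<one>\<close> and \<open>k = a \<otimes> b\<close> of
  \<open>act_base_in_cls_iff\<close>.\<close>

lemma subgroup_stab: "subgroup (stab l) G"
proof (rule subgroupI)
  show "stab l \<subseteq> carrier G" by (auto simp: stab_def)
  have one: "\<phi> \<one> base = base" using id_eq_one base by (metis restrict_apply')
  then have "\<one> \<in> stab l" using cls_self[OF base] by (simp add: stab_def)
  then show "stab l \<noteq> {}" by blast
  fix a assume a: "a \<in> stab l"
  then have aG: "a \<in> carrier G" and eq: "cls l (\<phi> a base) = cls l base"
    using cls_eq by (auto simp: stab_def)
  show "inv a \<in> stab l"
    using act_base_in_cls_iff[OF aG one_closed, of l] one eq cls_self[OF base] aG by simp
  fix b assume b: "b \<in> stab l"
  then have bG: "b \<in> carrier G" by (simp add: stab_def)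
  have "inv a \<otimes> (a \<otimes> b) \<in> stab l" using aG bG b by (simp add: m_assoc[symmetric])
  then have "\<phi> (a \<otimes> b) base \<in> cls l base"
    using act_base_in_cls_iff[OF aG, of "a \<otimes> b" l] aG bG eq by simp
  then show "a \<otimes> b \<in> stab l" using aG bG by (simp add: stab_def)
qed

lemma code_eq_coset:
  assumes "g \<in> code x l"
  shows "code x l = g <#\<^bsub>G\<^esub> stab l"
proof -
  have g: "g \<in> carrier G" "cls l (\<phi> g base) = cls l x"
    using assms cls_eq by (auto simp: code_def)
  show ?thesis
  proof (intro subset_antisym subsetI)
    fix k assume "k \<in> code x l"
    then have k: "k \<in> carrier G" "inv g \<otimes> k \<in> stab l"
      using act_base_in_cls_iff[OF g(1), of k] g by (auto simp: code_def)
    then show "k \<in> g <#\<^bsub>G\<^esub> stab l"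
      using subgroup.lcos_module_rev[OF subgroup_stab is_group g(1)] by blast
  next
    fix k assume k: "k \<in> g <#\<^bsub>G\<^esub> stab l"
    then have "k \<in> carrier G" "inv g \<otimes> k \<in> stab l"
      using l_coset_carrier[OF k g(1) subgroup_stab]
        subgroup.lcos_module_imp[OF subgroup_stab is_group g(1)] by auto
    then show "k \<in> code x l"
      using act_base_in_cls_iff[OF g(1), of k l] g by (simp add: code_def)
  qed
qed

lemma code_act_base: "g \<in> carrier G \<Longrightarrow> code (\<phi> g base) l = g <#\<^bsub>G\<^esub> stab l"
  using code_eq_coset[of g "\<phi> g base" l] cls_self action_closed base by (simp add: code_def)

lemma code_in_lcosets: "x \<in> topspace X \<Longrightarrow> code x l \<in> lcosets (stab l)"
  using code_nonempty[of x l] code_eq_coset unfolding LCOSETS_def code_def by blast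

lemma code_cong: "y \<in> cls l x \<Longrightarrow> code y l = code x l"
  unfolding code_def using cls_eq by simp

text \<open>This is compatibility with the bonding maps: an element of \<open>code x (Suc l)\<close>
  also lies in \<open>code x l\<close>, hence represents both cosets.\<close>

lemma code_mult_stab:
  assumes "x \<in> topspace X"
  shows "code x (Suc l) <#> stab l = code x l"
proof (intro subset_antisym subsetI)
  have sub: "code x (Suc l) \<subseteq> code x l" using cls_Suc unfolding code_def by blast
  fix k
  {
    assume "k \<in> code x (Suc l) <#> stab l"
    then obtain a b where "a \<in> code x (Suc l)" "b \<in> stab l" "k = a \<otimes> b"
      unfolding set_mult_def by blast
    then show "k \<in> code x l" using code_eq_coset[of a x l] sub unfolding l_coset_def by blast
  next
    obtain g where "g \<in> code x (Suc l)" using code_nonempty[OF assms] by blast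
    moreover assume "k \<in> code x l"
    ultimately show "k \<in> code x (Suc l) <#> stab l"
      using code_eq_coset[of g x l] sub unfolding l_coset_def set_mult_def by blast
  }
qed

lemma group_chain_stab: "group_chain G stab"
  unfolding group_chain_def
proof (intro conjI allI)
  \<comment> \<open>At level 0 no coordinate is compared, so there is only one class.\<close>
  show "stab 0 = carrier G" using action_closed base by (auto simp: stab_def cls_def)
  fix l
  show "subgroup (stab l) G" by (rule subgroup_stab)
  show "stab (Suc l) \<subseteq> stab l" using cls_Suc unfolding stab_def by blast
  \<comment> \<open>Each coset is the set of elements moving the base point into some class, so
    finitely many classes give finite index.\<close>
  have "lcosets (stab l) \<subseteq> (\<lambda>S. {g \<in> carrier G. \<phi> g base \<in> S}) ` cls l ` topspace X"
  proof
    fix A assume "A \<in> lcosets (stab l)"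
    then obtain g where g: "g \<in> carrier G" "A = code (\<phi> g base) l"
      unfolding LCOSETS_def using code_act_base by auto
    then show "A \<in> (\<lambda>S. {g \<in> carrier G. \<phi> g base \<in> S}) ` cls l ` topspace X"
      using action_closed base unfolding code_def by blast
  qed
  then show "finite (lcosets (stab l))" using finite_cls finite_subset by blast
qed

lemma code_equivariant:
  assumes g: "g \<in> carrier G" and x: "x \<in> topspace X"
  shows "code (\<phi> g x) = chain_action G g (code x)"
proof
  fix l
  obtain a where a: "a \<in> code x l" using code_nonempty[OF x] by blast
  then have aG: "a \<in> carrier G" by (simp add: code_def)
  have "\<phi> (g \<otimes> a) base \<in> cls l (\<phi> g x)"
    using composition_rule[OF base g aG] cls_act[OF _ g x, of "\<phi> a base" l] a by (simp add: code_def)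
  then have "g \<otimes> a \<in> code (\<phi> g x) l" using g aG by (simp add: code_def)
  then have "code (\<phi> g x) l = (g \<otimes> a) <#\<^bsub>G\<^esub> stab l" by (rule code_eq_coset)
  also have "\<dots> = g <#\<^bsub>G\<^esub> (a <#\<^bsub>G\<^esub> stab l)"
    using g aG subgroup.subset[OF subgroup_stab] by (simp add: lcos_m_assoc)
  also have "a <#\<^bsub>G\<^esub> stab l = code x l" using code_eq_coset[OF a] by simp
  finally show "code (\<phi> g x) l = chain_action G g (code x) l" by (simp add: chain_action_def)
qed

section \<open>The coding as a homeomorphism onto the inverse limit\<close>

lemma continuous_code_component:
  "continuous_map X (discrete_topology (lcosets (stab l))) (\<lambda>x. code x l)"
  unfolding continuous_map_def
proof (intro conjI allI impI)
  show "(\<lambda>x. code x l) \<in> topspace X \<rightarrow> topspace (discrete_topology (lcosets (stab l)))"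
    using code_in_lcosets by simp
  fix U
  show "openin X {x \<in> topspace X. code x l \<in> U}"
  proof (subst openin_subopen, intro ballI)
    fix x assume x: "x \<in> {x \<in> topspace X. code x l \<in> U}"
    \<comment> \<open>The code at level \<open>l\<close> is locally constant, being constant on open
      classes.\<close>
    have "cls l x \<subseteq> {x \<in> topspace X. code x l \<in> U}"
    proof
      fix y assume y: "y \<in> cls l x"
      then have "y \<in> topspace X" by (simp add: cls_def)
      then show "y \<in> {x \<in> topspace X. code x l \<in> U}" using code_cong[OF y] x by simp
    qed
    then show "\<exists>T. openin X T \<and> x \<in> T \<and> T \<subseteq> {x \<in> topspace X. code x l \<in> U}"
      using openin_cls[of x l] cls_self[of x l] x by (intro exI[of _ "cls l x"]) simp
  qed
qed

lemma topspace_chain_limit_stab: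
  "topspace (chain_limit G stab)
    = {A. \<forall>l. A l \<in> lcosets (stab l) \<and> A (Suc l) <#> stab l = A l}"
  unfolding chain_limit_def by (auto simp: PiE_iff)

text \<open>A continuous bijection from a compact space to a Hausdorff space is a homeomorphism.
  Surjectivity comes from compactness, injectivity from that of the coordinate map
  \<open>c\<close>.\<close>

lemma homeomorphic_code: "homeomorphic_map X (chain_limit G stab) code"
proof (rule continuous_imp_homeomorphic_map)
  show "compact_space X" by (rule compact)
  show "Hausdorff_space (chain_limit G stab)"
    unfolding chain_limit_def
    by (intro Hausdorff_space_subtopology) (simp add: Hausdorff_space_product_topology)
  have "code ` topspace X \<subseteq> topspace (chain_limit G stab)"
    unfolding topspace_chain_limit_stab using code_in_lcosets code_mult_stab by auto
  moreover have "A \<in> code ` topspace X" if "A \<in> topspace (chain_limit G stab)" for A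
  proof -
    have A: "A l \<in> lcosets (stab l)" "A (Suc l) <#> stab l = A l" for l
      using that unfolding topspace_chain_limit_stab by auto
    \<comment> \<open>\<open>K l\<close> collects the points with the prescribed coset at level
      \<open>l\<close>. These closed nonempty sets are nested, and a common point has code
      \<open>A\<close>.\<close>
    define K where "K l = {x \<in> topspace X. code x l \<in> {A l}}" for l
    have "(\<Inter>l. K l) \<noteq> {}"
    proof (rule compact_space_imp_nest[OF compact])
      fix l
      show "closedin X (K l)"
        unfolding K_def using A
        by (intro closedin_continuous_map_preimage[OF continuous_code_component]) simp
      obtain g where "g \<in> carrier G" "A l = code (\<phi> g base) l"
        using A(1)[of l] code_act_base unfolding LCOSETS_def by auto
      then show "K l \<noteq> {}" unfolding K_def using action_closed base by blast
    next
      have "K (Suc l) \<subseteq> K l" for l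
      proof
        fix x assume "x \<in> K (Suc l)"
        then show "x \<in> K l" using code_mult_stab[of x l] A(2)[of l] by (simp add: K_def)
      qed
      then show "decseq K" by (rule decseq_SucI)
    qed
    then obtain x where x: "x \<in> (\<Inter>l. K l)" by blast
    then have "x \<in> topspace X" "code x l = A l" for l by (auto simp: K_def)
    then show ?thesis by blast
  qed
  ultimately show "code ` topspace X = topspace (chain_limit G stab)" by blast
  then show "continuous_map X (chain_limit G stab) code"
    unfolding chain_limit_def continuous_map_in_subtopology continuous_map_componentwise_UNIV
    using continuous_code_component code_mult_stab by auto
  show "inj_on code (topspace X)"
  proof (rule inj_onI)
    fix x y assume xy: "x \<in> topspace X" "y \<in> topspace X" "code x = code y"
    have "c x i = c y i" for i
    proof -
      \<comment> \<open>Level \<open>Suc i\<close> is used because classes of level \<open>l\<close>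
        compare only coordinates below \<open>l\<close>. A common element of both codes puts
        \<open>x\<close> and \<open>y\<close> in one class, and \<open>\<one>\<close> then compares
        coordinate \<open>i\<close> of the points themselves.\<close>
      obtain g where g: "g \<in> code x (Suc i)" using code_nonempty[OF xy(1)] by blast
      then have "g \<in> code y (Suc i)" using xy(3) by simp
      with g have "\<phi> g base \<in> cls (Suc i) x" "\<phi> g base \<in> cls (Suc i) y"
        by (simp_all add: code_def)
      then have "cls (Suc i) x = cls (Suc i) y" using cls_eq by blast
      then have "x \<in> cls (Suc i) y" using cls_self[OF xy(1)] by blast
      then have "c (\<phi> \<one> x) i = c (\<phi> \<one> y) i" by (simp add: cls_def)
      then show ?thesis using id_eq_one xy by (metis restrict_apply')
    qed
    then have "c x = c y" by blast
    then show "x = y" using inj_onD[OF inj_c _ xy(1,2)] by blast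
  qed
qed

lemma group_chain_model_stab: "group_chain_model X G \<phi> stab"
  unfolding group_chain_model_def using group_chain_stab homeomorphic_code code_equivariant by blast

end

section \<open>Odometers admit the coding\<close>

lemma odometer_group_chain_model_exists:
  fixes G :: "('g, 'm) monoid_scheme"
  assumes "odometer X G \<phi>"
  shows "\<exists>C. group_chain_model X G \<phi> C" and "topspace X \<noteq> {}"
proof -
  let ?P = "product_topology (\<lambda>_::nat. discrete_topology (UNIV :: bool set)) UNIV"
  have act: "group_action G (topspace X) \<phi>" and min: "minimal_action X G \<phi>"
    and eqc: "equicontinuous_action X G \<phi>" and "X homeomorphic_space ?P"
    using assms unfolding odometer_def cantor_action_def cantor_space_def by auto
  then obtain c where c: "homeomorphic_map X ?P c"
    unfolding homeomorphic_space by blast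
  have comp: "compact_space X"
    using homeomorphic_compact_space[OF homeomorphic_map_imp_homeomorphic_space[OF c]]
    by (simp add: compact_space_product_topology compact_space_discrete_topology)
  have "c ` topspace X = UNIV" using homeomorphic_imp_surjective_map[OF c] by simp
  then show ne: "topspace X \<noteq> {}" by blast
  then obtain b where b: "b \<in> topspace X" by blast
  interpret group_action G "topspace X" \<phi> by (rule act)
  interpret group G using group_hom group_hom.axioms(1) by auto
  obtain d where d: "Metric_space (topspace X) d" "Metric_space.mtopology (topspace X) d = X"
    and equi: "\<And>\<epsilon>. \<epsilon> > 0 \<Longrightarrow> \<exists>\<delta>>0. \<forall>x\<in>topspace X. \<forall>y\<in>topspace X.
           d x y < \<delta> \<longrightarrow> (\<forall>g\<in>carrier G. d (\<phi> g x) (\<phi> g y) < \<epsilon>)"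
    using eqc unfolding equicontinuous_action_def by blast
  interpret M: Metric_space "topspace X" d by (rule d(1))
  have agree: "openin X {y \<in> topspace X. \<forall>g\<in>carrier G. c (\<phi> g y) i = c (\<phi> g x) i}" (is "openin X ?S")
    if x: "x \<in> topspace X" for x i
  proof -
    let ?U = "\<lambda>v. {y \<in> topspace X. c y i \<in> {v}}"
    have cont: "continuous_map X (discrete_topology UNIV) (\<lambda>y. c y i)"
      using homeomorphic_imp_continuous_map[OF c] by (simp add: continuous_map_componentwise_UNIV)
    have "openin X (?U v)" for v
      by (rule openin_continuous_map_preimage[OF cont]) simp
    then have "\<And>U. U \<in> range ?U \<Longrightarrow> openin M.mtopology U"
      unfolding d(2) by blast
    moreover have "compactin M.mtopology (topspace X)"
      using comp unfolding d(2) compact_space_def .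
    moreover have "topspace X \<subseteq> \<Union> (range ?U)" by auto
    \<comment> \<open>\<epsilon> is a Lebesgue number of the open cover by the sets on which
      coordinate \<open>i\<close> is constant, so points closer than \<epsilon> share this
      coordinate.\<close>
    ultimately obtain \<epsilon> where \<epsilon>: "\<epsilon> > 0" "\<forall>y\<in>topspace X. \<exists>U\<in>range ?U. M.mball y \<epsilon> \<subseteq> U"
      using M.lebesgue_number by meson
    have near: "c y i = c z i" if yz: "y \<in> topspace X" "z \<in> topspace X" "d y z < \<epsilon>" for y z
    proof -
      obtain v where "M.mball y \<epsilon> \<subseteq> ?U v" using \<epsilon>(2) yz(1) by blast
      moreover have "y \<in> M.mball y \<epsilon>" "z \<in> M.mball y \<epsilon>" using yz \<epsilon>(1) by auto
      ultimately show ?thesis by blast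
    qed
    \<comment> \<open>By equicontinuity, points closer than \<delta> stay closer than \<epsilon>
      along their whole orbits. Hence \<open>?S\<close> contains the ball of radius \<delta> around
      each of its points.\<close>
    obtain \<delta> where \<delta>: "\<delta> > 0" "\<forall>y\<in>topspace X. \<forall>z\<in>topspace X.
        d y z < \<delta> \<longrightarrow> (\<forall>g\<in>carrier G. d (\<phi> g y) (\<phi> g z) < \<epsilon>)"
      using equi[OF \<epsilon>(1)] by blast
    have "M.mball y \<delta> \<subseteq> ?S" if y: "y \<in> ?S" for y
    proof
      fix z assume "z \<in> M.mball y \<delta>"
      then have z: "y \<in> topspace X" "z \<in> topspace X" "d y z < \<delta>" by auto
      have "c (\<phi> g z) i = c (\<phi> g x) i" if g: "g \<in> carrier G" for g
      proof -
        have "d (\<phi> g y) (\<phi> g z) < \<epsilon>" using \<delta>(2) z g by blast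
        then have "c (\<phi> g y) i = c (\<phi> g z) i" using near action_closed g z by blast
        then show ?thesis using y g by simp
      qed
      then show "z \<in> ?S" using z by simp
    qed
    then have "openin M.mtopology ?S" unfolding M.openin_mtopology using \<delta>(1) by blast
    then show ?thesis unfolding d(2) .
  qed
  interpret odometer_coding G X \<phi> c b
    by unfold_locales (use comp min b agree homeomorphic_imp_injective_map[OF c] in auto)
  show "\<exists>C. group_chain_model X G \<phi> C" using group_chain_model_stab by blast
qed

section \<open>Return equivalent odometers have the same typeset\<close>

lemma typeset_eq_return_group:
  assumes "comm_group G" "odometer X G \<phi>" "adapted X G \<phi> U"
  shows "typeset X G \<phi> = action_typeset (subtopology X U) (return_group G \<phi> U) (\<lambda>f. f)"
proof -
  \<comment> \<open>The chain comes from a choice operator, so it is known to be a model only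
    because some model exists.\<close>
  define C where "C = (SOME C. group_chain_model X G \<phi> C)"
  have "group_chain_model X G \<phi> C"
    unfolding C_def using odometer_group_chain_model_exists(1)[OF assms(2)] by (rule someI_ex)
  then obtain h where h: "group_chain G C" "homeomorphic_map X (chain_limit G C) h"
    "\<And>g x. g \<in> carrier G \<Longrightarrow> x \<in> topspace X \<Longrightarrow> h (\<phi> g x) = chain_action G g (h x)"
    unfolding group_chain_model_def by blast
  interpret comm_group G by fact
  interpret group_action G "topspace X" \<phi>
    using assms(2) unfolding odometer_def cantor_action_def by blast
  interpret abelian_chain_model G X \<phi> C h
    by unfold_locales (use h odometer_group_chain_model_exists(2)[OF assms(2)] in auto)
  show ?thesis
    unfolding typeset_def C_def[symmetric] chain_typeset_eq_action_typeset
    by (rule action_typeset_eq_return_group[OF assms(3)])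
qed

theorem corollary1p9:
  fixes X :: "'x topology" and G :: "('g, 'm) monoid_scheme" and \<phi> :: "'g \<Rightarrow> 'x \<Rightarrow> 'x"
    and X' :: "'y topology" and G' :: "('h, 'n) monoid_scheme" and \<phi>' :: "'h \<Rightarrow> 'y \<Rightarrow> 'y"
  assumes "comm_group G" and "comm_group G'"
    and "odometer X G \<phi>" and "odometer X' G' \<phi>'"
    and "return_equivalent X G \<phi> X' G' \<phi>'"
  shows "typeset X G \<phi> = typeset X' G' \<phi>'"
proof -
  obtain U U' where U: "adapted X G \<phi> U" and U': "adapted X' G' \<phi>' U'"
    and iso: "isomorphic_actions (subtopology X U) (return_group G \<phi> U) (\<lambda>f. f)
      (subtopology X' U') (return_group G' \<phi>' U') (\<lambda>f. f)"
    using assms(5) unfolding return_equivalent_def by blast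
  \<comment> \<open>This is the hypothesis \<open>maps\<close> of the transport along isomorphisms:
    elements of the return group map \<open>U'\<close> onto itself.\<close>
  have "f ` topspace (subtopology X' U') \<subseteq> topspace (subtopology X' U')"
    if f: "f \<in> carrier (return_group G' \<phi>' U')" for f
  proof -
    obtain g where g: "g \<in> return_subgroup G' \<phi>' U'" "f = restrict (\<phi>' g) U'"
      using f unfolding carrier_return_group by blast
    have "topspace (subtopology X' U') = U'"
      using U' closedin_subset[of X' U'] unfolding adapted_def by (simp add: Int_absorb1)
    then show ?thesis using return_subgroup_image[OF U' g(1)] g(2) by simp
  qed
  from isomorphic_actions_imp_action_typeset_eq[OF iso this] show ?thesis
    unfolding typeset_eq_return_group[OF assms(1,3) U] typeset_eq_return_group[OF assms(2,4) U'] .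
qed

end
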